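(* Let $\{m_I\}_{I\in\binom{[n]}{2}}$ and $\{M_I\}_{I\in\binom{[n]}{2}}$ be two families of positive real numbers with $m_I<M_I$ for every $I$. There exists a positive-weighted tree $\mathcal T=(T,w)$ with $L(T)=[n]$ such that $D_I(\mathcal T)\in(m_I,M_I)$ for every $I\in\binom{[n]}{2}$ if and only if there exists a system $S$ of splits of the quartets of $[n]$ such that (i) $S$ is fat, transitive and saturated, and (ii) $m_{\sigma_1}+\dots+m_{\sigma_r}<M_{\tau_1}+\dots+M_{\tau_s}$ for every $(\sigma_1,\dots,\sigma_r)$ and $(\tau_1,\dots,\tau_s)$ partitions of subsets of $[n]$ into $2$-sets such that $(\tau_1,\dots,\tau_s)$ can be obtained from $(\sigma_1,\dots,\sigma_r)$ by a sequence of transformations on the $2$-sets of the following kinds: replacing $\{i,k\},\{j,l\}$ by $\{i,j\},\{k,l\}$ whenever $(j,k\,|\,i,l)\in S$; replacing $\{i,k\},\{j,l\}$ by $\{i,j\},\{k,l\}$ whenever $(i,k\,|\,j,l)\in S$ and $(i,k\,|\,j,l)$ is the only split of $\{i,j,k,l\}$ in $S$; replacing $\{a,b\}$ by $\{a,c\},\{c,b\}$ for any $a,b,c\in[n]$.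
   Context: A positive-weighted tree $\mathcal T=(T,w)$ is a finite tree $T$ with a function $w:E(T)\to\mathbb R_{>0}$; $L(T)$ is its set of leaves. For distinct vertices $i,j$, $D_{\{i,j\}}(\mathcal T)=D_{i,j}(\mathcal T)$ is the sum of the weights of the edges of the unique path joining $i$ and $j$. $[n]=\{1,\dots,n\}$, $\binom{[n]}{2}$ is the set of $2$-subsets of $[n]$, and $m_{i,j}$ means $m_{\{i,j\}}$. A quartet is a $4$-subset of $[n]$; a split of a quartet $Y$ is a partition of $Y$ into two $2$-subsets, written $(a,b\,|\,c,d)$ for $\{\{a,b\},\{c,d\}\}$. A system $S$ of splits of quartets is fat if for every quartet either exactly one or all three of its splits lie in $S$; transitive if for distinct $a,b,c,d,e$, $(a,b|c,d)\in S$ and $(a,b|c,e)\in S$ imply $(a,b|d,e)\in S$; saturated if for distinct $a_1,a_2,b_1,b_2,x$, $(a_1,a_2|b_1,b_2)\in S$ implies $(a_1,x|b_1,b_2)\in S$ or $(a_1,a_2|b_1,x)\in S$.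
   Formalization: In (ii), the σ's and τ's are non-empty families of 2-sets that may overlap and repeat, not disjoint partitions (else the third move never applies and n=3, m_12=10, M_12=11, other m=1, M=2 is a counterexample); n≥2 is assumed, since no tree has exactly one leaf. *)

theory Defs
  imports
    "Graph_Theory.Pair_Digraph"
    "Graph_Theory.Digraph_Component"
    "HOL-Library.Multiset"
    "HOL-Library.Disjoint_Sets"
    "HOL-Library.Ramsey"
begin

section \<open>Positive-weighted trees\<close>

text \<open>
  A finite simple graph is a symmetric loopfree digraph (\<^locale>\<open>pair_graph\<close>); the undirected
  edge \<open>{u, v}\<close> is represented by the two arcs \<open>(u, v)\<close> and \<open>(v, u)\<close>. The constant
  \<^const>\<open>tree\<close> of Graph_Theory is not usable here: it forbids directed cycles, so the closed walk
  \<open>u, v, u\<close> along a single edge would count as a cycle. A cycle of an undirected simple graph is a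
  cycle with at least three arcs.
\<close>

definition undirected_tree :: "'a pair_pre_digraph \<Rightarrow> bool" where
  "undirected_tree T \<longleftrightarrow> pair_graph T \<and> connected (with_proj T) \<and>
     \<not> (\<exists>p. pre_digraph.cycle (with_proj T) p \<and> 3 \<le> length p)"

definition leaves :: "'a pair_pre_digraph \<Rightarrow> 'a set" where
  "leaves T = {v \<in> pverts T. out_degree (with_proj T) v = 1}"

text \<open>The weight is a function of the undirected edges, that is, of the 2-sets \<open>{u, v}\<close>.\<close>

definition positive_weighted_tree :: "'a pair_pre_digraph \<Rightarrow> ('a set \<Rightarrow> real) \<Rightarrow> bool" where
  "positive_weighted_tree T w \<longleftrightarrow> undirected_tree T \<and> (\<forall>(u, v) \<in> parcs T. 0 < w {u, v})"

definition tree_dist :: "'a pair_pre_digraph \<Rightarrow> ('a set \<Rightarrow> real) \<Rightarrow> 'a \<Rightarrow> 'a \<Rightarrow> real" where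
  "tree_dist T w i j =
     (\<Sum>(u, v) \<leftarrow> (THE p. pre_digraph.apath (with_proj T) i p j). w {u, v})"

section \<open>Systems of splits of quartets\<close>

text \<open>\<open>[A]\<^bsup>k\<^esup>\<close> is the set of \<open>k\<close>-subsets of \<open>A\<close>. The split \<open>(a, b | c, d)\<close> is \<open>{{a, b}, {c, d}}\<close>.\<close>

definition splits :: "'a set \<Rightarrow> 'a set set set" where
  "splits Y = {s. partition_on Y s \<and> s \<subseteq> [Y]\<^bsup>2\<^esup>}"

definition split_system :: "nat \<Rightarrow> nat set set set \<Rightarrow> bool" where
  "split_system n S \<longleftrightarrow> S \<subseteq> (\<Union>Y \<in> [{1..n}]\<^bsup>4\<^esup>. splits Y)"

definition fat :: "nat \<Rightarrow> nat set set set \<Rightarrow> bool" where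
  "fat n S \<longleftrightarrow> (\<forall>Y \<in> [{1..n}]\<^bsup>4\<^esup>. card (splits Y \<inter> S) = 1 \<or> splits Y \<subseteq> S)"

definition transitive :: "nat \<Rightarrow> nat set set set \<Rightarrow> bool" where
  "transitive n S \<longleftrightarrow>
     (\<forall>a\<in>{1..n}. \<forall>b\<in>{1..n}. \<forall>c\<in>{1..n}. \<forall>d\<in>{1..n}. \<forall>e\<in>{1..n}.
        distinct [a, b, c, d, e] \<and> {{a, b}, {c, d}} \<in> S \<and> {{a, b}, {c, e}} \<in> S
        \<longrightarrow> {{a, b}, {d, e}} \<in> S)"

definition saturated :: "nat \<Rightarrow> nat set set set \<Rightarrow> bool" where
  "saturated n S \<longleftrightarrow>
     (\<forall>a1\<in>{1..n}. \<forall>a2\<in>{1..n}. \<forall>b1\<in>{1..n}. \<forall>b2\<in>{1..n}. \<forall>x\<in>{1..n}.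
        distinct [a1, a2, b1, b2, x] \<and> {{a1, a2}, {b1, b2}} \<in> S
        \<longrightarrow> {{a1, x}, {b1, b2}} \<in> S \<or> {{a1, a2}, {b1, x}} \<in> S)"

section \<open>Transformations of families of 2-sets\<close>

text \<open>
  A tuple of 2-sets is taken up to order but with repetitions, i.e. as a multiset, and its members
  may overlap: replacing \<open>{a, b}\<close> by \<open>{a, c}, {c, b}\<close> always produces overlapping 2-sets.
\<close>

inductive transform :: "nat \<Rightarrow> nat set set set \<Rightarrow> nat set multiset \<Rightarrow> nat set multiset \<Rightarrow> bool"
  for n :: nat and S :: "nat set set set" where
  exchange: "\<lbrakk>distinct [i, j, k, l]; {{j, k}, {i, l}} \<in> S\<rbrakk>
    \<Longrightarrow> transform n S (R + {#{i, k}, {j, l}#}) (R + {#{i, j}, {k, l}#})"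
| exchange_only: "\<lbrakk>distinct [i, j, k, l]; splits {i, j, k, l} \<inter> S = {{{i, k}, {j, l}}}\<rbrakk>
    \<Longrightarrow> transform n S (R + {#{i, k}, {j, l}#}) (R + {#{i, j}, {k, l}#})"
| detour: "\<lbrakk>a \<in> {1..n}; b \<in> {1..n}; c \<in> {1..n}; distinct [a, b, c]\<rbrakk>
    \<Longrightarrow> transform n S (R + {#{a, b}#}) (R + {#{a, c}, {c, b}#})"

end

theory Submission
  imports Defs "HOL-Library.Sublist" "HOL-Library.Nat_Bijection"
begin

text \<open>
  From a tree, the four-point condition of its distance yields a fat, transitive and saturated system
  of quartet splits, and no transformation decreases the total distance of a family of pairs.

  Conversely, a fat, transitive and saturated system \<open>S\<close> determines a compatible family of splits of
  the leaves (the edges of a tree), and the edge weights have to solve a system of strict linear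
  inequalities. If this is not solvable, Farkas' lemma over the integers gives two families of pairs
  \<open>\<sigma>\<close>, \<open>\<tau>\<close> such that every edge is crossed at most as often by \<open>\<sigma>\<close> as by \<open>\<tau>\<close>, although
  \<open>m(\<sigma>) \<ge> M(\<tau>)\<close>. The combinatorial core is that \<open>2\<sigma>\<close> can be transformed into a subfamily of
  \<open>2\<tau>\<close>: doubling makes the excess on each edge even, pairs of \<open>\<sigma>\<close> are rerouted at inner vertices
  until one of them agrees with a pair of \<open>\<tau>\<close>, and whenever rerouting is blocked some excess can be
  used up by a detour or by joining two paths.
\<close>

text \<open>An exchange of the first kind changes the load of no edge, while a detour and an
  exchange of the second kind change each load by 0 or 2. So loads never decrease and their parity
  is invariant: an excess of 1 could never be used up. This forces the doubling, which costs nothing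
  because \<open>m(\<sigma>) \<ge> M(\<tau>)\<close> doubles with the families. Integer multipliers
  matter because a certificate must be read as two multisets of pairs. Until weights are known the
  tree is present only through its edges, encoded as subsets of the leaves, and its inner vertices,
  encoded as partitions into branches. The edges are Buneman's splits: every quartet with two leaves
  on either side has this pairing as its only split in \<open>S\<close>. Quartets with all three
  splits in \<open>S\<close> are star-shaped, and no edge cuts them two against two.\<close>

section \<open>Strict Farkas lemma over the integers\<close>

text \<open>Combinations with nonnegative integer multipliers that are not all zero. The empty
  combination is left out on purpose: with bound 0 it would certify against every strict
  system.\<close>

inductive_set cone :: "(('v \<Rightarrow> int) \<times> real) set \<Rightarrow> (('v \<Rightarrow> int) \<times> real) set"
  for C where
  gen: "c \<in> C \<Longrightarrow> c \<in> cone C"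
| add: "(a, b) \<in> cone C \<Longrightarrow> (a', b') \<in> cone C \<Longrightarrow> (\<lambda>v. a v + a' v, b + b') \<in> cone C"

lemma cone_scale:
  assumes "(a, b) \<in> cone C"
  shows "(\<lambda>v. int (Suc k) * a v, real (Suc k) * b) \<in> cone C"
proof (induction k)
  case 0
  then show ?case using assms by simp
next
  case (Suc k)
  from cone.add[OF assms Suc] show ?case by (simp add: algebra_simps)
qed

lemma cone_scale_pos:
  assumes "(a, b) \<in> cone C" "0 < z"
  shows "(\<lambda>v. z * a v, real_of_int z * b) \<in> cone C"
proof -
  have "int (Suc (nat z - 1)) = z" "real (Suc (nat z - 1)) = real_of_int z"
    using assms(2) by (auto simp: of_nat_diff)
  with cone_scale[OF assms(1), of "nat z - 1"] show ?thesis by simp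
qed

lemma cone_idem:
  assumes "C' \<subseteq> cone C"
  shows "cone C' \<subseteq> cone C"
proof
  fix c assume "c \<in> cone C'"
  then show "c \<in> cone C"
    by induction (use assms in \<open>auto intro: cone.add\<close>)
qed

lemma cone_vanish:
  assumes "c \<in> cone C" "\<And>a b. (a, b) \<in> C \<Longrightarrow> a v = 0"
  shows "fst c v = 0"
  using assms by (induction) auto

lemma between_finite:
  fixes L U :: "real set"
  assumes "finite L" "finite U" "\<And>l u. l \<in> L \<Longrightarrow> u \<in> U \<Longrightarrow> l < u"
  shows "\<exists>t. (\<forall>l\<in>L. l < t) \<and> (\<forall>u\<in>U. t < u)"
proof (cases "L = {}")
  case True
  show ?thesis
  proof (cases "U = {}")
    case False
    have "Min U - 1 < u" if "u \<in> U" for u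
      using Min_le[OF assms(2) that] by linarith
    with True show ?thesis by auto
  qed (use True in auto)
next
  case L: False
  show ?thesis
  proof (cases "U = {}")
    case True
    have "l < Max L + 1" if "l \<in> L" for l
      using Max_ge[OF assms(1) that] by linarith
    with True show ?thesis by auto
  next
    case False
    have "Max L < Min U" using assms L False by simp
    then obtain t where "Max L < t" "t < Min U" using dense by blast
    with assms L False show ?thesis by auto
  qed
qed

text \<open>Fourier-Motzkin elimination: eliminating \<open>v\<close> only forms positive integral combinations of
  constraints, so that the certificate stays in the cone.\<close>
theorem strict_farkas:
  fixes C :: "(('v \<Rightarrow> int) \<times> real) set"
  assumes "finite V" "finite C"
  shows "(\<exists>x :: 'v \<Rightarrow> real. \<forall>(a, b) \<in> C. (\<Sum>v\<in>V. real_of_int (a v) * x v) < b) \<or>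
         (\<exists>(a, b) \<in> cone C. (\<forall>v\<in>V. a v = 0) \<and> b \<le> 0)"
  using assms
proof (induction V arbitrary: C rule: finite_induct)
  case empty
  show ?case
  proof (cases "\<forall>(a, b) \<in> C. 0 < b")
    case False
    then obtain a b where "(a, b) \<in> C" "b \<le> 0" by force
    then show ?thesis by (force intro: cone.gen)
  qed auto
next
  case (insert v V)
  define Z P N where "Z = {c \<in> C. fst c v = 0}" and "P = {c \<in> C. fst c v > 0}"
    and "N = {c \<in> C. fst c v < 0}"
  \<comment> \<open>Each multiplier is, up to sign, the coefficient of \<open>v\<close> in the other
    constraint: both are positive, and \<open>v\<close> cancels.\<close>
  define comb :: "(('v \<Rightarrow> int) \<times> real) \<times> (('v \<Rightarrow> int) \<times> real) \<Rightarrow> (('v \<Rightarrow> int) \<times> real)"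
    where "comb = (\<lambda>(p, q). (\<lambda>u. (- fst q v) * fst p u + fst p v * fst q u,
                     real_of_int (- fst q v) * snd p + real_of_int (fst p v) * snd q))"
  define C' where "C' = Z \<union> comb ` (P \<times> N)"
  have fin: "finite Z" "finite P" "finite N" "finite C'"
    using insert.prems by (auto simp: Z_def P_def N_def C'_def)
  have C'_cone: "C' \<subseteq> cone C"
  proof
    fix c assume "c \<in> C'"
    then consider "c \<in> Z" | p q where "p \<in> P" "q \<in> N" "c = comb (p, q)"
      by (auto simp: C'_def)
    then show "c \<in> cone C"
    proof cases
      case 2
      have "(fst p, snd p) \<in> cone C" "0 < - fst q v" "(fst q, snd q) \<in> cone C" "0 < fst p v"
        using 2 by (auto simp: P_def N_def intro: cone.gen)
      from cone.add[OF cone_scale_pos[OF this(1,2)] cone_scale_pos[OF this(3,4)]]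
      show ?thesis by (simp add: comb_def 2(3))
    qed (auto simp: Z_def intro: cone.gen)
  qed
  have C'_v: "a v = 0" if "(a, b) \<in> C'" for a b
    using that by (auto simp: C'_def Z_def comb_def)
  from insert.IH[OF fin(4)] show ?case
  proof
    assume "\<exists>x. \<forall>(a, b)\<in>C'. (\<Sum>u\<in>V. real_of_int (a u) * x u) < b"
    then obtain x :: "'v \<Rightarrow> real"
      where x: "\<And>a b. (a, b) \<in> C' \<Longrightarrow> (\<Sum>u\<in>V. real_of_int (a u) * x u) < b" by blast
    define val where "val c = (\<Sum>u\<in>V. real_of_int (fst c u) * x u)" for c :: "('v \<Rightarrow> int) \<times> real"
    \<comment> \<open>The bound that \<open>c\<close> puts on the value of \<open>v\<close> once the
      other variables are fixed: an upper bound for \<open>c\<close> in \<open>P\<close>, a lower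
      bound for \<open>c\<close> in \<open>N\<close>.\<close>
    define bd where "bd c = (snd c - val c) / real_of_int (fst c v)" for c
    have "\<exists>t. (\<forall>l\<in>bd ` N. l < t) \<and> (\<forall>u\<in>bd ` P. t < u)"
    proof (rule between_finite)
      fix l u assume "l \<in> bd ` N" "u \<in> bd ` P"
      then obtain q p where q: "q \<in> N" "l = bd q" and p: "p \<in> P" "u = bd p" by auto
      define \<alpha> \<beta> where "\<alpha> = real_of_int (fst p v)" and "\<beta> = - real_of_int (fst q v)"
      have pos: "0 < \<alpha>" "0 < \<beta>" using p q by (auto simp: \<alpha>_def \<beta>_def P_def N_def)
      have "comb (p, q) \<in> C'" using p q by (auto simp: C'_def)
      then have "(\<Sum>u\<in>V. real_of_int (fst (comb (p, q)) u) * x u) < snd (comb (p, q))"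
        using x by (metis prod.collapse)
      moreover have "(\<Sum>u\<in>V. real_of_int (fst (comb (p, q)) u) * x u) = \<beta> * val p + \<alpha> * val q"
        unfolding val_def comb_def \<alpha>_def \<beta>_def sum_distrib_left sum.distrib[symmetric]
        by (intro sum.cong) (auto simp: algebra_simps)
      moreover have "snd (comb (p, q)) = \<beta> * snd p + \<alpha> * snd q"
        by (simp add: comb_def \<alpha>_def \<beta>_def)
      ultimately have "\<alpha> * (val q - snd q) < \<beta> * (snd p - val p)" by (simp add: algebra_simps)
      then have "(val q - snd q) / \<beta> < (snd p - val p) / \<alpha>"
        using pos by (simp add: field_simps)
      moreover have "l = (val q - snd q) / \<beta>" "u = (snd p - val p) / \<alpha>"
        unfolding p q bd_def \<alpha>_def \<beta>_def by (simp_all add: minus_divide_left)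
      ultimately show "l < u" by simp
    qed (use fin in auto)
    then obtain t where "\<forall>l\<in>bd ` N. l < t" "\<forall>u\<in>bd ` P. t < u" by (elim exE conjE)
    then have t: "\<And>q. q \<in> N \<Longrightarrow> bd q < t" "\<And>p. p \<in> P \<Longrightarrow> t < bd p" by simp_all
    have "(\<Sum>u\<in>insert v V. real_of_int (fst c u) * (x(v := t)) u) < snd c" if c: "c \<in> C" for c
    proof -
      have "(\<Sum>u\<in>V. real_of_int (fst c u) * (x(v := t)) u) = val c"
        unfolding val_def using insert.hyps by (intro sum.cong) auto
      then have eq: "(\<Sum>u\<in>insert v V. real_of_int (fst c u) * (x(v := t)) u)
          = real_of_int (fst c v) * t + val c"
        using insert.hyps by simp
      consider "c \<in> Z" | "c \<in> P" | "c \<in> N" using c linorder_less_linear[of "fst c v" 0]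
        by (auto simp: Z_def P_def N_def)
      then have "real_of_int (fst c v) * t + val c < snd c"
      proof cases
        case 1
        then show ?thesis using x[of "fst c" "snd c"] by (auto simp: C'_def Z_def val_def)
      next
        case 2
        then have "0 < real_of_int (fst c v)" by (auto simp: P_def)
        with t(2)[OF 2] show ?thesis by (simp add: bd_def field_simps)
      next
        case 3
        then have "real_of_int (fst c v) < 0" by (auto simp: N_def)
        with t(1)[OF 3] show ?thesis by (simp add: bd_def field_simps)
      qed
      with eq show ?thesis by simp
    qed
    then have "\<forall>(a, b)\<in>C. (\<Sum>u\<in>insert v V. real_of_int (a u) * (x(v := t)) u) < b"
      by (simp add: case_prod_beta)
    then show ?case by blast
  next
    assume "\<exists>(a, b)\<in>cone C'. (\<forall>u\<in>V. a u = 0) \<and> b \<le> 0"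
    then obtain a b where ab: "(a, b) \<in> cone C'" "\<forall>u\<in>V. a u = 0" "b \<le> 0" by blast
    \<comment> \<open>The certificate for \<open>C'\<close> only speaks of \<open>V\<close>, but
      \<open>v\<close> was eliminated from every generator.\<close>
    have "a v = 0" using cone_vanish[OF ab(1), of v] C'_v by auto
    with ab cone_idem[OF C'_cone] show ?case by blast
  qed
qed

section \<open>Splits of the leaves carried by a quartet system\<close>

lemma splits_quartet:
  assumes "distinct [a, b, c, d]"
  shows "splits {a, b, c, d} = {{{a, b}, {c, d}}, {{a, c}, {b, d}}, {{a, d}, {b, c}}}" (is "?L = ?R")
proof
  show "?R \<subseteq> ?L"
    using assms by (auto simp: splits_def partition_on_def disjoint_def)
  show "?L \<subseteq> ?R"
  proof
    fix s assume "s \<in> ?L"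
    then have s: "\<Union>s = {a, b, c, d}" "\<And>A B. A \<in> s \<Longrightarrow> B \<in> s \<Longrightarrow> A \<noteq> B \<Longrightarrow> A \<inter> B = {}"
      and sub: "\<And>A. A \<in> s \<Longrightarrow> A \<subseteq> {a, b, c, d} \<and> card A = 2"
      by (auto simp: splits_def partition_on_def disjoint_def nsets_def)
    obtain A where A: "A \<in> s" "a \<in> A" using s(1) by blast
    then obtain x where x: "A = {a, x}" "x \<in> {b, c, d}"
      using sub[OF A(1)] by (auto simp: card_2_iff)
    \<comment> \<open>\<open>A\<close> is the block of \<open>a\<close>, with partner
      \<open>x\<close>. Any other block avoids \<open>A\<close>, so it is \<open>{y, z}\<close>, and
      nothing is left for a third.\<close>
    have key: "s = {{a, x}, {y, z}}"
      if x: "A = {a, x}" and yz: "{a, b, c, d} = {a, x, y, z}" "distinct [a, x, y, z]" for x y z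
    proof -
      have "y \<in> \<Union>s" unfolding s(1) yz(1) by simp
      then obtain B where B: "B \<in> s" "y \<in> B" by blast
      have "B \<noteq> A" using B x yz(2) by auto
      then have "A \<inter> B = {}" using s(2) A B by blast
      moreover have "B \<subseteq> {a, x, y, z}" "card B = 2" using sub[OF B(1)] yz(1) by simp_all
      ultimately have "B \<subseteq> {y, z}" using x by blast
      then have Beq: "B = {y, z}" using \<open>card B = 2\<close> yz(2)
        by (intro card_seteq) auto
      have "C = A \<or> C = B" if "C \<in> s" for C
      proof (rule ccontr)
        assume "\<not> (C = A \<or> C = B)"
        then have "C \<inter> A = {}" "C \<inter> B = {}" using s(2) A B that by blast+
        moreover have "C \<subseteq> {a, x, y, z}" "card C = 2" using sub[OF that] yz(1) by simp_all
        ultimately have "C = {}" using x Beq by blast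
        with \<open>card C = 2\<close> show False by simp
      qed
      with A B show ?thesis using x Beq by blast
    qed
    consider "x = b" | "x = c" | "x = d" using x by blast
    then show "s \<in> ?R"
    proof cases
      case 1
      with key[of b c d] x assms show ?thesis by simp
    next
      case 2
      then have "s = {{a, c}, {b, d}}" using key[of c b d] x assms by (auto simp: insert_commute)
      then show ?thesis by simp
    next
      case 3
      then have "s = {{a, d}, {b, c}}" using key[of d b c] x assms by (auto simp: insert_commute)
      then show ?thesis by simp
    qed
  qed
qed

lemma splits_quartet_distinct:
  assumes "distinct [a, b, c, d]"
  shows "{{a, b}, {c, d}} \<noteq> {{a, c}, {b, d}}" "{{a, b}, {c, d}} \<noteq> {{a, d}, {b, c}}"
    "{{a, c}, {b, d}} \<noteq> {{a, d}, {b, c}}"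
  using assms by (auto simp: doubleton_eq_iff)

lemma three_Int_card:
  assumes "A \<noteq> B" "A \<noteq> C" "B \<noteq> C" "card ({A, B, C} \<inter> S) = 1 \<or> {A, B, C} \<subseteq> S"
  shows "A \<in> S \<and> B \<in> S \<and> C \<in> S \<or> A \<in> S \<and> B \<notin> S \<and> C \<notin> S \<or>
    A \<notin> S \<and> B \<in> S \<and> C \<notin> S \<or> A \<notin> S \<and> B \<notin> S \<and> C \<in> S"
  using assms by (cases "A \<in> S"; cases "B \<in> S"; cases "C \<in> S") auto

lemma three_Int_eq:
  assumes "A \<noteq> B" "A \<noteq> C" "B \<noteq> C"
  shows "{A, B, C} \<inter> S = {A} \<longleftrightarrow> A \<in> S \<and> B \<notin> S \<and> C \<notin> S"
  using assms by auto

locale quartet_system =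
  fixes n :: nat and S :: "nat set set set"
  assumes split_system: "split_system n S" and fat: "fat n S"
    and transitive: "transitive n S" and saturated: "saturated n S"
begin

definition N :: "nat set" where "N = {1..n}"

lemma finite_N: "finite N"
  by (simp add: N_def)

definition is_split :: "nat \<Rightarrow> nat \<Rightarrow> nat \<Rightarrow> nat \<Rightarrow> bool" where
  "is_split a b c d \<longleftrightarrow> {{a, b}, {c, d}} \<in> S"

text \<open>Stronger than \<open>is_split\<close>, which also holds for the pairings of a
  star-shaped quartet. A resolved quartet has an inner edge separating the two pairs.\<close>

definition resolved :: "nat \<Rightarrow> nat \<Rightarrow> nat \<Rightarrow> nat \<Rightarrow> bool" where
  "resolved a b c d \<longleftrightarrow> splits {a, b, c, d} \<inter> S = {{{a, b}, {c, d}}}"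

lemma is_split_sym:
  "is_split b a c d = is_split a b c d" "is_split a b d c = is_split a b c d"
  "is_split c d a b = is_split a b c d"
  unfolding is_split_def by (simp_all only: insert_commute)

lemma resolved_iff:
  assumes "distinct [a, b, c, d]"
  shows "resolved a b c d \<longleftrightarrow> is_split a b c d \<and> \<not> is_split a c b d \<and> \<not> is_split a d b c"
  unfolding resolved_def is_split_def splits_quartet[OF assms]
  by (intro three_Int_eq splits_quartet_distinct assms)

lemma is_split_fat:
  assumes "distinct [a, b, c, d]" "{a, b, c, d} \<subseteq> N"
  shows "is_split a b c d \<and> is_split a c b d \<and> is_split a d b c \<or>
    is_split a b c d \<and> \<not> is_split a c b d \<and> \<not> is_split a d b c \<or>
    \<not> is_split a b c d \<and> is_split a c b d \<and> \<not> is_split a d b c \<or>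
    \<not> is_split a b c d \<and> \<not> is_split a c b d \<and> is_split a d b c"
proof -
  have "{a, b, c, d} \<in> [N]\<^bsup>4\<^esup>" using assms by (auto simp: nsets_def)
  then have "card (splits {a, b, c, d} \<inter> S) = 1 \<or> splits {a, b, c, d} \<subseteq> S"
    using fat unfolding fat_def N_def by blast
  then show ?thesis
    unfolding splits_quartet[OF assms(1)] is_split_def
    by (intro three_Int_card splits_quartet_distinct assms)
qed

lemma is_split_trans:
  assumes "distinct [a, b, c, d, e]" "{a, b, c, d, e} \<subseteq> N" "is_split a b c d" "is_split a b c e"
  shows "is_split a b d e"
proof -
  have "a \<in> N" "b \<in> N" "c \<in> N" "d \<in> N" "e \<in> N" using assms(2) by auto
  with assms transitive show ?thesis unfolding transitive_def is_split_def N_def by blast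
qed

lemma is_split_sat:
  assumes "distinct [a, b, c, d, x]" "{a, b, c, d, x} \<subseteq> N" "is_split a b c d"
  shows "is_split a x c d \<or> is_split a b c x"
proof -
  have "a \<in> N" "b \<in> N" "c \<in> N" "d \<in> N" "x \<in> N" using assms(2) by auto
  with assms saturated show ?thesis unfolding saturated_def is_split_def N_def by blast
qed

section \<open>Transitivity and saturation for uniquely split quartets\<close>

lemma resolved_sym:
  "resolved b a c d = resolved a b c d" "resolved a b d c = resolved a b c d"
  "resolved c d a b = resolved a b c d"
  unfolding resolved_def by (simp_all only: insert_commute)

lemma resolved_unique:
  assumes "distinct [a, b, c, d]" "resolved a b c d" "resolved a c b d"
  shows False
proof -
  have "distinct [a, c, b, d]" using assms(1) by auto
  with assms show False using resolved_iff[of a b c d] resolved_iff[of a c b d] by blast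
qed

text \<open>Transitivity of \<open>S\<close> gives \<open>a b | d e\<close>. If that quartet were a
  star, \<open>a d | b e\<close> would be in \<open>S\<close> too, and saturation by
  \<open>c\<close> would put \<open>a c | b e\<close> or \<open>a d | b c\<close> into
  \<open>S\<close>, against uniqueness.\<close>

lemma resolved_trans:
  assumes "distinct [a, b, c, d, e]" "{a, b, c, d, e} \<subseteq> N" "resolved a b c d" "resolved a b c e"
  shows "resolved a b d e"
proof (rule ccontr)
  assume neg: "\<not> resolved a b d e"
  have r: "is_split a b c d" "\<not> is_split a c b d" "\<not> is_split a d b c" "is_split a b c e" "\<not> is_split a c b e" "\<not> is_split a e b c"
    using assms resolved_iff[of a b c d] resolved_iff[of a b c e] by auto
  have "is_split a b d e" using is_split_trans[of a b c d e] assms r by blast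
  then have "is_split a d b e" using neg is_split_fat[of a b d e] resolved_iff[of a b d e] assms by auto
  then have "is_split a c b e \<or> is_split a d b c" using is_split_sat[of a d b e c] assms by auto
  with r show False by blast
qed

lemma resolved_sat:
  assumes "distinct [a, b, c, d, x]" "{a, b, c, d, x} \<subseteq> N" "resolved a b c d"
  shows "resolved a x c d \<or> resolved a b c x"
proof (rule ccontr)
  \<comment> \<open>Saturation of \<open>S\<close> may deliver \<open>a x | c d\<close> as one of
    three splits of a star. This star, saturated by \<open>b\<close>, together with transitivity
    forces \<open>a b | c x\<close> into \<open>S\<close> and keeps \<open>a c | b x\<close> out of
    it, so that \<open>a b | c x\<close> is resolved after all.\<close>
  have key: False
    if h: "distinct [a, b, c, d, x]" "{a, b, c, d, x} \<subseteq> N" "resolved a b c d"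
      "is_split a x c d" "\<not> resolved a x c d" "\<not> resolved a b c x" for a b c d x
  proof -
    have r: "is_split a b c d" "\<not> is_split a c b d" "\<not> is_split a d b c"
      using h resolved_iff[of a b c d] by auto
    have st: "is_split a c x d" "is_split a d x c"
      using h is_split_fat[of a x c d] resolved_iff[of a x c d] by auto
    have no: "\<not> is_split a c x b"
    proof
      assume "is_split a c x b"
      then have "is_split a c d b" using is_split_trans[of a c x d b] st h by auto
      with r show False by (simp add: is_split_sym)
    qed
    then have "\<not> is_split a c b x" by (simp add: is_split_sym)
    then have n1: "\<not> is_split a b c x"
      using h is_split_fat[of a b c x] resolved_iff[of a b c x] by auto
    have "is_split a b x d \<or> is_split a c x b"
      using is_split_sat[of a c x d b] st h by auto
    with no have "is_split a b d x" by (simp add: is_split_sym)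
    moreover have "is_split a b d c" using r by (simp add: is_split_sym)
    ultimately have "is_split a b c x" using is_split_trans[of a b d c x] h by auto
    with n1 show False by blast
  qed
  assume neg: "\<not> (resolved a x c d \<or> resolved a b c x)"
  have r: "is_split a b c d" using assms resolved_iff[of a b c d] by auto
  then have "is_split a x c d \<or> is_split a b c x" using is_split_sat assms by blast
  then show False
  proof
    assume "is_split a x c d" with key[of a b c d x] neg assms show False by blast
  next
    assume "is_split a b c x"
    \<comment> \<open>The other alternative is the same situation with the two pairs of the split
      interchanged.\<close>
    then have "is_split c x a b" by (simp add: is_split_sym)
    moreover have "resolved c d a b" "\<not> resolved c x a b" "\<not> resolved c d a x"
      using assms neg by (simp_all add: resolved_sym)
    ultimately show False using key[of c d a b x] assms by auto
  qed
qed

text \<open>An edge enters with both of its sides. The quartet condition is vacuous when a side has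
  a single element, so the pendant edges are included automatically.\<close>

definition sides :: "nat set set" where
  "sides = {X. X \<subseteq> N \<and> X \<noteq> {} \<and> X \<noteq> N \<and>
     (\<forall>a\<in>X. \<forall>a'\<in>X. \<forall>b\<in>N - X. \<forall>b'\<in>N - X. a \<noteq> a' \<longrightarrow> b \<noteq> b' \<longrightarrow> resolved a a' b b')}"

lemma sidesD:
  assumes "X \<in> sides"
  shows "X \<subseteq> N" "X \<noteq> {}" "X \<noteq> N" "finite X"
  using assms by (auto simp: sides_def intro: finite_subset[OF _ finite_N])

lemma sides_resolved:
  assumes "X \<in> sides" "a \<in> X" "a' \<in> X" "b \<in> N" "b' \<in> N" "b \<notin> X" "b' \<notin> X" "a \<noteq> a'" "b \<noteq> b'"
  shows "resolved a a' b b'"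
  using assms by (auto simp: sides_def)

lemma finite_sides: "finite sides"
  by (rule finite_subset[of _ "Pow N"]) (auto simp: sides_def finite_N)

lemma sides_compl:
  assumes "X \<in> sides"
  shows "N - X \<in> sides"
proof -
  have "resolved a a' b b'"
    if "a \<in> N - X" "a' \<in> N - X" "b \<in> N - (N - X)" "b' \<in> N - (N - X)" "a \<noteq> a'" "b \<noteq> b'" for a a' b b'
    using sides_resolved[OF assms, of b b' a a'] that by (auto simp: resolved_sym)
  moreover have "N - X \<noteq> {}" "N - X \<noteq> N" using sidesD[OF assms] by blast+
  ultimately show ?thesis by (simp add: sides_def)
qed

lemma sides_singleton:
  assumes "x \<in> N" "{x} \<noteq> N"
  shows "{x} \<in> sides"
  using assms by (auto simp: sides_def)

text \<open>Otherwise a leaf from each of the four intersections of the sides and their complements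
  gives a quartet that is resolved in two different ways.\<close>

lemma sides_compatible:
  assumes "X \<in> sides" "Y \<in> sides"
  shows "X \<subseteq> Y \<or> Y \<subseteq> X \<or> X \<inter> Y = {} \<or> X \<union> Y = N"
proof (rule ccontr)
  assume "\<not> ?thesis"
  then obtain p q r t where "p \<in> X - Y" "q \<in> Y - X" "r \<in> X \<inter> Y" "t \<in> N - (X \<union> Y)"
    using sidesD(1)[OF assms(1)] sidesD(1)[OF assms(2)] by blast
  moreover from this have "distinct [r, p, q, t]" "p \<in> N" "q \<in> N"
    using sidesD(1)[OF assms(1)] sidesD(1)[OF assms(2)] by auto
  ultimately show False
    using sides_resolved[OF assms(1), of r p q t] sides_resolved[OF assms(2), of r q p t]
      resolved_unique[of r p q t] by auto
qed

text \<open>A maximal pair \<open>A\<close>, \<open>B\<close> of sets that are mutually resolved covers \<open>{1..n}\<close>: a point \<open>x\<close> that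
  cannot join \<open>A\<close> can join \<open>B\<close>.\<close>
lemma sides_separate:
  assumes "distinct [a, b, c, d]" "{a, b, c, d} \<subseteq> N" "resolved a b c d"
  shows "\<exists>X\<in>sides. a \<in> X \<and> b \<in> X \<and> c \<notin> X \<and> d \<notin> X"
proof -
  define good where "good = (\<lambda>(A, B). A \<subseteq> N \<and> B \<subseteq> N \<and> {a, b} \<subseteq> A \<and> {c, d} \<subseteq> B \<and> A \<inter> B = {} \<and>
    (\<forall>x\<in>A. \<forall>x'\<in>A. \<forall>y\<in>B. \<forall>y'\<in>B. x \<noteq> x' \<longrightarrow> y \<noteq> y' \<longrightarrow> resolved x x' y y'))"
  have "good ({a, b}, {c, d})"
    using assms by (auto simp: good_def resolved_sym)
  moreover have "\<forall>P. good P \<longrightarrow> card (fst P \<union> snd P) < Suc (card N)"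
    by (auto simp: good_def less_Suc_eq_le intro!: card_mono finite_N)
  ultimately obtain P where P: "good P"
    and P_max: "\<And>Q. good Q \<Longrightarrow> card (fst Q \<union> snd Q) \<le> card (fst P \<union> snd P)"
    using ex_has_greatest_nat[of good "({a, b}, {c, d})" "\<lambda>P. card (fst P \<union> snd P)" "Suc (card N)"]
    by blast
  obtain A B where AB: "P = (A, B)" by fastforce
  have AN: "A \<subseteq> N" "B \<subseteq> N" "{a, b} \<subseteq> A" "{c, d} \<subseteq> B" "A \<inter> B = {}"
    and res: "\<And>x x' y y'. x \<in> A \<Longrightarrow> x' \<in> A \<Longrightarrow> y \<in> B \<Longrightarrow> y' \<in> B \<Longrightarrow> x \<noteq> x' \<Longrightarrow> y \<noteq> y' \<Longrightarrow>
      resolved x x' y y'"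
    using P by (auto simp: good_def AB)
  have finAB: "finite A" "finite B" using AN finite_N by (auto intro: finite_subset)
  have "A \<union> B = N"
  proof (rule ccontr)
    assume "A \<union> B \<noteq> N"
    then obtain x where x: "x \<in> N" "x \<notin> A" "x \<notin> B" using AN by blast
    have "card (insert x A \<union> B) > card (A \<union> B)" "card (A \<union> insert x B) > card (A \<union> B)"
      using x finAB by auto
    then have not_good: "\<not> good (insert x A, B)" "\<not> good (A, insert x B)"
      using P_max[of "(insert x A, B)"] P_max[of "(A, insert x B)"] by (auto simp: AB)
    obtain u y y' where u: "u \<in> A" "y \<in> B" "y' \<in> B" "y \<noteq> y'" "\<not> resolved u x y y'"
    proof -
      have "\<exists>u\<in>A. \<exists>y\<in>B. \<exists>y'\<in>B. y \<noteq> y' \<and> \<not> resolved u x y y'"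
      proof (rule ccontr)
        assume "\<not> ?thesis"
        then have "good (insert x A, B)"
          using AN x res by (auto simp: good_def resolved_sym)
        with not_good show False by blast
      qed
      with that show thesis by blast
    qed
    \<comment> \<open>\<open>u\<close>, \<open>y\<close>, \<open>y'\<close> witness that
      \<open>x\<close> cannot join \<open>A\<close>. Saturating \<open>u v | y y'\<close> by
      \<open>x\<close> therefore leaves only \<open>u v | y x\<close>, and transitivity replaces
      \<open>y\<close> by any \<open>z\<close> in \<open>B\<close>.\<close>
    have move: "resolved u v z x" if v: "v \<in> A" "v \<noteq> u" and z: "z \<in> B" for v z
    proof -
      have 1: "resolved u v y x"
      proof -
        have "distinct [u, v, y, y', x]" using u v x AN by auto
        then show ?thesis using resolved_sat[of u v y y' x] res[of u v y y'] u v x AN by auto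
      qed
      show ?thesis
      proof (cases "z = y")
        case False
        have "distinct [u, v, y, z, x]" using u v x z AN False by auto
        then show ?thesis using resolved_trans[of u v y z x] res[of u v y z] 1 u v x z AN by auto
      qed (use 1 in simp)
    qed
    have "resolved v v' z x" if v: "v \<in> A" "v' \<in> A" "v \<noteq> v'" and z: "z \<in> B" for v v' z
    proof -
      consider "v = u" | "v' = u" | "v \<noteq> u" "v' \<noteq> u" by blast
      then show ?thesis
      proof cases
        case 1
        then show ?thesis using move[of v' z] v z by simp
      next
        case 2
        then show ?thesis using move[of v z] v z by (simp add: resolved_sym)
      next
        case 3
        \<comment> \<open>Both splits share \<open>u\<close>, which transitivity then
          removes.\<close>
        have "resolved z x u v" "resolved z x u v'"
          using move[of v z] move[of v' z] v z 3 by (simp_all add: resolved_sym)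
        moreover have "distinct [z, x, u, v, v']" "{z, x, u, v, v'} \<subseteq> N"
          using u v x z AN 3 by auto
        ultimately have "resolved z x v v'" using resolved_trans by blast
        then show ?thesis by (simp add: resolved_sym)
      qed
    qed
    then have "good (A, insert x B)"
      using AN x res by (auto simp: good_def resolved_sym)
    with not_good show False by blast
  qed
  then have B: "N - A = B" using AN(5) by blast
  have "A \<noteq> {}" "A \<noteq> N" using AN assms(2) by auto
  then have "A \<in> sides"
    unfolding sides_def mem_Collect_eq B using AN(1) by (intro conjI ballI impI) (auto intro: res)
  moreover have "a \<in> A" "b \<in> A" "c \<notin> A" "d \<notin> A" using AN by auto
  ultimately show ?thesis by blast
qed

text \<open>An inner vertex of the tree is represented by the partition of the leaves into the branches
  at that vertex.\<close>
definition vertex :: "nat set set \<Rightarrow> bool" where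
  "vertex P \<longleftrightarrow> partition_on N P \<and> P \<subseteq> sides \<and> (\<forall>X\<in>sides. \<exists>B\<in>P. X \<subseteq> B \<or> N - X \<subseteq> B)"

text \<open>This is the end of the edge \<open>H\<close> lying towards \<open>H\<close>. Its
  branches are the outside of \<open>H\<close> and the maximal sides properly inside
  \<open>H\<close>. Compatibility makes the latter disjoint; they cover \<open>H\<close> because
  singletons are sides, and properly smaller ones by the cardinality assumption.\<close>

lemma vertex_exists:
  assumes H: "H \<in> sides" and "2 \<le> card H"
  shows "\<exists>P. vertex P \<and> N - H \<in> P \<and> H \<notin> P"
proof -
  define K where "K = {X \<in> sides. X \<subset> H \<and> (\<forall>Y\<in>sides. X \<subset> Y \<longrightarrow> \<not> Y \<subset> H)}"
  have in_K: "\<exists>B\<in>K. X \<subseteq> B" if "X \<in> sides" "X \<subset> H" for X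
  proof -
    have "finite {Y \<in> sides. Y \<subset> H}" using finite_sides by simp
    from finite_has_maximal2[OF this, of X] that
    obtain B where "B \<in> {Y \<in> sides. Y \<subset> H}" "X \<subseteq> B" "\<forall>Y\<in>{Y \<in> sides. Y \<subset> H}. B \<subseteq> Y \<longrightarrow> B = Y"
      by blast
    then show ?thesis unfolding K_def by blast
  qed
  have single: "{x} \<in> sides" "{x} \<subset> H" if "x \<in> H" for x
  proof -
    have "{x} \<noteq> H" using assms(2) by auto
    then show "{x} \<subset> H" using that by blast
    then show "{x} \<in> sides" using sidesD(1)[OF H] that by (intro sides_singleton) auto
  qed
  define P where "P = insert (N - H) K"
  have K_H: "X \<subset> H" "X \<in> sides" if "X \<in> K" for X using that by (auto simp: K_def)
  have "partition_on N P"
  proof (rule partition_onI)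
    have "x \<in> \<Union>K" if "x \<in> H" for x using in_K[OF single[OF that]] by blast
    moreover have "X \<subseteq> H" if "X \<in> K" for X using K_H(1)[OF that] by auto
    ultimately have "\<Union>K = H" by blast
    then show "\<Union>P = N" using sidesD(1)[OF H] unfolding P_def by auto
    fix X Y assume XY: "X \<in> P" "Y \<in> P" "X \<noteq> Y"
    show "disjnt X Y"
    proof (cases "X \<in> K \<and> Y \<in> K")
      case True
      then have "\<not> X \<subset> Y" "\<not> Y \<subset> X" using K_H unfolding K_def by blast+
      moreover have "X \<union> Y \<noteq> N" using K_H True sidesD[OF H] by blast
      ultimately show ?thesis using sides_compatible[of X Y] True K_H XY(3) unfolding disjnt_def by blast
    next
      case False
      then show ?thesis using XY K_H unfolding P_def disjnt_def by blast
    qed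
  next
    have "X \<in> sides" if "X \<in> P" for X using K_H(2) sides_compl[OF H] that unfolding P_def by blast
    then show "{} \<notin> P" using sidesD(2) by blast
  qed
  moreover have "P \<subseteq> sides" using sides_compl[OF H] K_H unfolding P_def by blast
  moreover have "\<exists>B\<in>P. X \<subseteq> B \<or> N - X \<subseteq> B" if X: "X \<in> sides" for X
  proof -
    have sub: "X \<subseteq> N" "H \<subseteq> N" using sidesD X H by blast+
    consider "X \<subset> H" | "X = H" | "H \<subseteq> X" | "X \<inter> H = {}" | "N - X \<subset> H" | "N - X = H"
      using sides_compatible[OF X H] by blast
    then show ?thesis
    proof cases
      case 1
      then show ?thesis using in_K[OF X] unfolding P_def by blast
    next
      case 5
      then show ?thesis using in_K[OF sides_compl[OF X]] unfolding P_def by blast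
    qed (use sub in \<open>auto simp: P_def\<close>)
  qed
  ultimately have "vertex P" unfolding vertex_def by blast
  moreover have "H \<notin> P" using sidesD(2)[OF H] K_H(1) unfolding P_def by blast
  moreover have "N - H \<in> P" by (simp add: P_def)
  ultimately show ?thesis by blast
qed

end

section \<open>Realizing load inequalities by transformations\<close>

text \<open>The path between two leaves uses the edge with side \<open>X\<close> exactly if
  \<open>X\<close> separates them; \<open>load\<close> counts these paths with multiplicity.\<close>

definition crosses :: "'a set \<Rightarrow> 'a set \<Rightarrow> bool" where
  "crosses p X \<longleftrightarrow> p \<inter> X \<noteq> {} \<and> \<not> p \<subseteq> X"

definition load :: "'a set multiset \<Rightarrow> 'a set \<Rightarrow> nat" where
  "load \<rho> X = (\<Sum>p\<in>#\<rho>. of_bool (crosses p X))"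

lemma crosses_pair [simp]: "crosses {a, b} X \<longleftrightarrow> (a \<in> X) \<noteq> (b \<in> X)"
  by (auto simp: crosses_def)

lemma load_simps [simp]:
  "load {#} X = 0" "load (add_mset p \<rho>) X = of_bool (crosses p X) + load \<rho> X"
  "load (\<rho> + \<tau>) X = load \<rho> X + load \<tau> X"
  by (simp_all add: load_def)

lemma load_pos_iff: "0 < load \<rho> X \<longleftrightarrow> (\<exists>p. p \<in># \<rho> \<and> crosses p X)"
  by (induction \<rho>) auto

lemma load_compl:
  assumes "set_mset \<rho> \<subseteq> [A]\<^bsup>2\<^esup>" "X \<subseteq> A"
  shows "load \<rho> (A - X) = load \<rho> X"
  using assms(1)
proof (induction \<rho>)
  case (add p \<rho>)
  then obtain x y where "p = {x, y}" "x \<in> A" "y \<in> A" by (auto elim: nsets2_E)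
  then show ?case using add by auto
qed simp

text \<open>A pair inside one block crosses no block; otherwise it crosses exactly the two blocks of
  its ends. So the sum is 0 for a path missing the vertex, 1 for a path through the vertex using
  \<open>E\<close>, and 2 for one avoiding \<open>E\<close>.\<close>

lemma crosses_block_sum:
  assumes P: "partition_on A P" "finite P" and E: "E \<in> P" and p: "p \<in> [A]\<^bsup>2\<^esup>"
  shows "of_bool (crosses p E) \<le> (\<Sum>B\<in>P - {E}. of_bool (crosses p B) :: nat)"
    and "(\<exists>B\<in>P. p \<subseteq> B) \<or> crosses p E \<Longrightarrow>
      of_bool (crosses p E) = (\<Sum>B\<in>P - {E}. of_bool (crosses p B) :: nat)"
    and "\<not> (\<exists>B\<in>P. p \<subseteq> B) \<Longrightarrow> \<not> crosses p E \<Longrightarrow>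
      of_bool (crosses p E) < (\<Sum>B\<in>P - {E}. of_bool (crosses p B) :: nat)"
proof -
  obtain x y where xy: "p = {x, y}" "x \<in> A" "y \<in> A" using p by (auto elim: nsets2_E)
  have dis: "B = C" if "z \<in> B" "z \<in> C" "B \<in> P" "C \<in> P" for B C z
    using P(1) that by (auto simp: partition_on_def disjoint_def)
  obtain Bx where Bx: "Bx \<in> P" "x \<in> Bx" using P(1) xy by (auto simp: partition_on_def)
  obtain By where By: "By \<in> P" "y \<in> By" using P(1) xy by (auto simp: partition_on_def)
  have mem: "x \<in> C \<longleftrightarrow> C = Bx" "y \<in> C \<longleftrightarrow> C = By" if "C \<in> P" for C
    using dis Bx By that by blast+
  have crs: "crosses p C \<longleftrightarrow> (C = Bx) \<noteq> (C = By)" if "C \<in> P" for C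
    using mem[OF that] xy by simp
  have "(\<Sum>B\<in>P - {E}. of_bool (crosses p B) :: nat) = (\<Sum>B\<in>P - {E}. of_bool (B \<in> {Bx, By} \<and> Bx \<noteq> By))"
    by (intro sum.cong) (auto simp: crs)
  also have "\<dots> = (if Bx = By then 0 else card ({Bx, By} - {E}))"
    using P(2) Bx By by (auto simp: of_bool_def sum.If_cases intro!: arg_cong[where f = card])
  finally have S: "(\<Sum>B\<in>P - {E}. of_bool (crosses p B) :: nat) = (if Bx = By then 0 else card ({Bx, By} - {E}))" .
  have same: "(\<exists>B\<in>P. p \<subseteq> B) \<longleftrightarrow> Bx = By" unfolding xy(1) using Bx(1) by (auto simp: mem)
  show "of_bool (crosses p E) \<le> (\<Sum>B\<in>P - {E}. of_bool (crosses p B) :: nat)"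
    "(\<exists>B\<in>P. p \<subseteq> B) \<or> crosses p E \<Longrightarrow>
      of_bool (crosses p E) = (\<Sum>B\<in>P - {E}. of_bool (crosses p B) :: nat)"
    "\<not> (\<exists>B\<in>P. p \<subseteq> B) \<Longrightarrow> \<not> crosses p E \<Longrightarrow>
      of_bool (crosses p E) < (\<Sum>B\<in>P - {E}. of_bool (crosses p B) :: nat)"
    unfolding S same crs[OF E] by (auto simp: insert_Diff_if)
qed

text \<open>Equality holds when every path through the vertex uses the branch \<open>E\<close>, and
  one path avoiding \<open>E\<close> makes the inequality strict. Comparing two families in this way
  locates a branch with slack.\<close>

lemma load_block_sum:
  assumes "partition_on A P" "finite P" "E \<in> P" "set_mset \<rho> \<subseteq> [A]\<^bsup>2\<^esup>"
  shows "load \<rho> E \<le> (\<Sum>B\<in>P - {E}. load \<rho> B)"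
    and "(\<And>p. p \<in># \<rho> \<Longrightarrow> (\<exists>B\<in>P. p \<subseteq> B) \<or> crosses p E) \<Longrightarrow> load \<rho> E = (\<Sum>B\<in>P - {E}. load \<rho> B)"
    and "p \<in># \<rho> \<Longrightarrow> \<not> (\<exists>B\<in>P. p \<subseteq> B) \<Longrightarrow> \<not> crosses p E \<Longrightarrow> load \<rho> E < (\<Sum>B\<in>P - {E}. load \<rho> B)"
proof -
  have le: "load \<rho> E \<le> (\<Sum>B\<in>P - {E}. load \<rho> B)" if "set_mset \<rho> \<subseteq> [A]\<^bsup>2\<^esup>" for \<rho>
    using that
  proof (induction \<rho>)
    case (add p \<rho>)
    then show ?case
      using add_mono[OF crosses_block_sum(1)[OF assms(1-3), of p], of "load \<rho> E" "\<Sum>B\<in>P - {E}. load \<rho> B"]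
      by (simp add: sum.distrib)
  qed simp
  from le[OF assms(4)] show "load \<rho> E \<le> (\<Sum>B\<in>P - {E}. load \<rho> B)" .
  show "load \<rho> E = (\<Sum>B\<in>P - {E}. load \<rho> B)"
    if "\<And>p. p \<in># \<rho> \<Longrightarrow> (\<exists>B\<in>P. p \<subseteq> B) \<or> crosses p E"
    using that assms(4)
  proof (induction \<rho>)
    case (add p \<rho>)
    then show ?case
      using crosses_block_sum(2)[OF assms(1-3), of p] by (simp add: sum.distrib)
  qed simp
  show "load \<rho> E < (\<Sum>B\<in>P - {E}. load \<rho> B)"
    if p: "p \<in># \<rho>" "\<not> (\<exists>B\<in>P. p \<subseteq> B)" "\<not> crosses p E"
  proof -
    obtain \<rho>' where \<rho>': "\<rho> = add_mset p \<rho>'" using p(1) by (metis mset_add)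
    then have "of_bool (crosses p E) + load \<rho>' E <
      (\<Sum>B\<in>P - {E}. of_bool (crosses p B)) + (\<Sum>B\<in>P - {E}. load \<rho>' B)"
      using assms(4) p(2,3) by (intro add_less_le_mono crosses_block_sum(3)[OF assms(1-3)] le) auto
    then show ?thesis unfolding \<rho>' by (simp add: sum.distrib)
  qed
qed

lemma transform_add: "transform n S \<rho> \<rho>' \<Longrightarrow> transform n S (K + \<rho>) (K + \<rho>')"
proof (induction rule: transform.induct)
  case (exchange i j k l R)
  from transform.exchange[OF this, of n "K + R"] show ?case by (simp add: add.assoc)
next
  case (exchange_only i j k l R)
  from transform.exchange_only[OF this, of n "K + R"] show ?case by (simp add: add.assoc)
next
  case (detour a b c R)
  from transform.detour[OF this, of S "K + R"] show ?case by (simp add: add.assoc)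
qed

lemma transform_rtranclp_add:
  "(transform n S)\<^sup>*\<^sup>* \<rho> \<rho>' \<Longrightarrow> (transform n S)\<^sup>*\<^sup>* (K + \<rho>) (K + \<rho>')"
  by (induction rule: rtranclp_induct) (auto intro: rtranclp.rtrancl_into_rtrancl transform_add)

section \<open>Inner vertices and load-preserving exchanges\<close>

context quartet_system
begin

text \<open>The path from \<open>x\<close> to \<open>y\<close> passes through the vertex
  \<open>P\<close>.\<close>

definition apart :: "nat set set \<Rightarrow> nat \<Rightarrow> nat \<Rightarrow> bool" where
  "apart P x y \<longleftrightarrow> (\<forall>B\<in>P. \<not> (x \<in> B \<and> y \<in> B))"

lemma apart_sym: "apart P x y \<longleftrightarrow> apart P y x"
  by (auto simp: apart_def)

lemma vertex_block_unique:
  assumes "vertex P" "B \<in> P" "C \<in> P" "x \<in> B" "x \<in> C"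
  shows "B = C"
  using assms by (auto simp: vertex_def partition_on_def disjoint_def)

lemma apart_blocks:
  assumes "vertex P" "B \<in> P" "x \<in> B" "y \<notin> B"
  shows "apart P x y"
  unfolding apart_def using vertex_block_unique[OF assms(1,2) _ assms(3)] assms(4) by blast

lemma finite_vertex: "vertex P \<Longrightarrow> finite P"
  using finite_subset[OF _ finite_sides] by (auto simp: vertex_def)

lemma vertex_block:
  assumes "vertex P" "x \<in> N"
  shows "\<exists>B\<in>P. x \<in> B"
  using assms by (auto simp: vertex_def partition_on_def)

text \<open>A side separating \<open>i, j\<close> from \<open>k, l\<close> has the vertex on one of
  its two ends, so the pair on the far side lies in a single branch.\<close>

lemma apart_not_resolved:
  assumes P: "vertex P" and N: "distinct [i, j, k, l]" "{i, j, k, l} \<subseteq> N"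
    and "apart P i j" "apart P k l"
  shows "\<not> resolved i j k l"
proof
  assume "resolved i j k l"
  then obtain X where X: "X \<in> sides" "i \<in> X" "j \<in> X" "k \<notin> X" "l \<notin> X"
    using sides_separate N by blast
  then obtain B where B: "B \<in> P" "X \<subseteq> B \<or> N - X \<subseteq> B" using P unfolding vertex_def by blast
  then have "i \<in> B \<and> j \<in> B \<or> k \<in> B \<and> l \<in> B" using X N(2) by auto
  with B(1) assms(4,5) show False unfolding apart_def by blast
qed

text \<open>Neither of the other two splits can be the only one, since each pairs leaves whose paths
  meet the vertex; fatness leaves \<open>l b | a j\<close> in \<open>S\<close>.\<close>

lemma apart_exchange:
  assumes "vertex P" "distinct [a, b, l, j]" "{a, b, l, j} \<subseteq> N"
    and "apart P a b" "apart P l j" "apart P a l" "apart P b j"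
  shows "is_split l b a j"
proof -
  have "\<not> resolved l a b j" "\<not> resolved l j b a"
    using apart_not_resolved[of P l a b j] apart_not_resolved[of P l j b a] assms by (auto simp: apart_sym)
  moreover have "distinct [l, b, a, j]" "{l, b, a, j} \<subseteq> N" "distinct [l, a, b, j]" "distinct [l, j, b, a]"
    using assms by auto
  ultimately show ?thesis
    using is_split_fat[of l b a j] resolved_iff[of l a b j] resolved_iff[of l j b a]
    by (auto simp: is_split_sym)
qed

lemma exchange_step:
  assumes "distinct [a, b, l, j]" "is_split l b a j"
  shows "transform n S (R + {#{a, b}, {l, j}#}) (R + {#{a, l}, {b, j}#})"
proof -
  have "distinct [a, l, b, j]" "{{l, b}, {a, j}} \<in> S" using assms by (auto simp: is_split_def)
  from transform.exchange[OF this, of n R] show ?thesis .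
qed

text \<open>With \<open>l b | a j\<close> in \<open>S\<close>, neither \<open>a b | l j\<close> nor
  \<open>a l | b j\<close> is resolved, so no side cuts the quartet in these two ways. On every
  other side both pairings cross equally often.\<close>

lemma exchange_crosses:
  assumes "distinct [a, b, l, j]" "{a, b, l, j} \<subseteq> N" "is_split l b a j" and X: "X \<in> sides"
  shows "of_bool (crosses {a, l} X) + of_bool (crosses {b, j} X) =
    (of_bool (crosses {a, b} X) + of_bool (crosses {l, j} X) :: nat)"
proof -
  have "\<not> resolved a b l j" "\<not> resolved a l b j"
    using assms resolved_iff[of a b l j] resolved_iff[of a l b j] by (auto simp: is_split_sym)
  then have "\<not> (a \<in> X \<and> b \<in> X \<and> l \<notin> X \<and> j \<notin> X)" "\<not> (l \<in> X \<and> j \<in> X \<and> a \<notin> X \<and> b \<notin> X)"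
    "\<not> (a \<in> X \<and> l \<in> X \<and> b \<notin> X \<and> j \<notin> X)" "\<not> (b \<in> X \<and> j \<in> X \<and> a \<notin> X \<and> l \<notin> X)"
    using sides_resolved[OF X, of a b l j] sides_resolved[OF X, of l j a b]
      sides_resolved[OF X, of a l b j] sides_resolved[OF X, of b j a l] assms(1,2)
    by (auto simp: resolved_sym)
  then show ?thesis by auto
qed

section \<open>Dominated families and progress towards the target\<close>

abbreviation reach :: "nat set multiset \<Rightarrow> nat set multiset \<Rightarrow> bool" where
  "reach \<equiv> (transform n S)\<^sup>*\<^sup>*"

text \<open>By the parity clause a positive excess is at least 2, which is exactly what a detour or
  a joining of two paths consumes.\<close>

definition dominated :: "nat set multiset \<Rightarrow> nat set multiset \<Rightarrow> bool" where
  "dominated \<rho> \<tau> \<longleftrightarrow> set_mset \<rho> \<subseteq> [N]\<^bsup>2\<^esup> \<and> set_mset \<tau> \<subseteq> [N]\<^bsup>2\<^esup> \<and>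
     (\<forall>X\<in>sides. load \<rho> X \<le> load \<tau> X \<and> (even (load \<rho> X) \<longleftrightarrow> even (load \<tau> X)))"

definition slack :: "nat set multiset \<Rightarrow> nat set multiset \<Rightarrow> nat" where
  "slack \<rho> \<tau> = (\<Sum>X\<in>sides. load \<tau> X - load \<rho> X)"

text \<open>The two outcomes are those that decrease \<open>slack\<close> plus the size of
  \<open>\<tau>\<close>: less slack, or a common pair that can be removed from both
  families.\<close>

definition progress :: "nat set multiset \<Rightarrow> nat set multiset \<Rightarrow> bool" where
  "progress \<rho> \<tau> \<longleftrightarrow> (\<exists>\<rho>'. reach \<rho> \<rho>' \<and> dominated \<rho>' \<tau> \<and>
     (slack \<rho>' \<tau> < slack \<rho> \<tau> \<or> slack \<rho>' \<tau> = slack \<rho> \<tau> \<and> (\<exists>p. p \<in># \<rho>' \<and> p \<in># \<tau>)))"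

lemma progress_transform:
  assumes "transform n S \<rho> \<rho>'" "slack \<rho>' \<tau> = slack \<rho> \<tau>" "progress \<rho>' \<tau>"
  shows "progress \<rho> \<tau>"
  using assms unfolding progress_def by (metis converse_rtranclp_into_rtranclp)

lemma exchange_dominated:
  assumes "dominated (R + {#{a, b}, {l, j}#}) \<tau>" "distinct [a, b, l, j]" "is_split l b a j"
  shows "dominated (R + {#{a, l}, {b, j}#}) \<tau>"
    "slack (R + {#{a, l}, {b, j}#}) \<tau> = slack (R + {#{a, b}, {l, j}#}) \<tau>"
proof -
  have N: "{a, b, l, j} \<subseteq> N" using assms(1) by (auto simp: dominated_def)
  have load: "load (R + {#{a, l}, {b, j}#}) X = load (R + {#{a, b}, {l, j}#}) X" if "X \<in> sides" for X
    using exchange_crosses[OF assms(2) N assms(3) that] by (simp del: crosses_pair)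
  show "dominated (R + {#{a, l}, {b, j}#}) \<tau>"
  proof -
    have "set_mset (R + {#{a, l}, {b, j}#}) \<subseteq> [N]\<^bsup>2\<^esup>" "set_mset \<tau> \<subseteq> [N]\<^bsup>2\<^esup>"
      using assms(1,2) by (auto simp: dominated_def)
    moreover have "load (R + {#{a, l}, {b, j}#}) X \<le> load \<tau> X \<and>
        (even (load (R + {#{a, l}, {b, j}#}) X) \<longleftrightarrow> even (load \<tau> X))" if "X \<in> sides" for X
      unfolding load[OF that] using assms(1) that unfolding dominated_def by blast
    ultimately show ?thesis unfolding dominated_def by blast
  qed
  show "slack (R + {#{a, l}, {b, j}#}) \<tau> = slack (R + {#{a, b}, {l, j}#}) \<tau>"
    unfolding slack_def by (intro sum.cong refl) (simp only: load)
qed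

text \<open>\<open>inc\<close> marks the edges that a step loads twice more. Positive excess there
  suffices because parity turns it into 2, and the edge \<open>H\<close> makes the drop in slack
  strict.\<close>

lemma progress_increase:
  assumes dom: "dominated \<rho> \<tau>" and tr: "transform n S \<rho> \<rho>'" and sub: "set_mset \<rho>' \<subseteq> [N]\<^bsup>2\<^esup>"
    and load: "\<And>X. X \<in> sides \<Longrightarrow> load \<rho>' X = load \<rho> X + 2 * of_bool (inc X)"
    and inc: "\<And>X. X \<in> sides \<Longrightarrow> inc X \<Longrightarrow> load \<rho> X < load \<tau> X"
    and H: "H \<in> sides" "inc H"
  shows "progress \<rho> \<tau>"
proof -
  have le: "load \<rho>' X \<le> load \<tau> X" "even (load \<rho>' X) \<longleftrightarrow> even (load \<tau> X)" if X: "X \<in> sides" for X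
  proof -
    have "load \<rho> X \<le> load \<tau> X" "even (load \<rho> X) \<longleftrightarrow> even (load \<tau> X)"
      using dom X by (auto simp: dominated_def)
    moreover from this have "load \<rho> X + 2 \<le> load \<tau> X" if "inc X"
      using inc[OF X that] by presburger
    ultimately show "load \<rho>' X \<le> load \<tau> X" "even (load \<rho>' X) \<longleftrightarrow> even (load \<tau> X)"
      using load[OF X] by auto
  qed
  have "dominated \<rho>' \<tau>" using dom sub le by (auto simp: dominated_def)
  moreover have "slack \<rho>' \<tau> < slack \<rho> \<tau>"
    unfolding slack_def
  proof (rule sum_strict_mono_ex1[OF finite_sides])
    show "\<forall>X\<in>sides. load \<tau> X - load \<rho>' X \<le> load \<tau> X - load \<rho> X" using load by auto
    show "\<exists>X\<in>sides. load \<tau> X - load \<rho>' X < load \<tau> X - load \<rho> X"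
      using H load[OF H(1)] inc[OF H] by (intro bexI[of _ H]) auto
  qed
  ultimately show ?thesis unfolding progress_def using tr by blast
qed

text \<open>Following branches whose load may still grow, one reaches a leaf or a path of \<open>\<rho>\<close> that can be
  joined to the outside of \<open>H\<close>.\<close>
lemma descend:
  assumes "dominated \<rho> \<tau>" "H \<in> sides" "load \<rho> H < load \<tau> H"
  shows "(\<exists>c\<in>H. \<forall>X\<in>sides. c \<in> X \<longrightarrow> X \<subseteq> H \<longrightarrow> load \<rho> X < load \<tau> X) \<or>
    (\<exists>j\<in>H. \<exists>l\<in>H. j \<noteq> l \<and> {j, l} \<in># \<rho> \<and> (\<forall>X\<in>sides. j \<in> X \<longrightarrow> l \<in> X \<longrightarrow> X \<subseteq> H \<longrightarrow> load \<rho> X < load \<tau> X))"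
  using assms(2,3)
proof (induction "card H" arbitrary: H rule: less_induct)
  case less
  have HN: "H \<subseteq> N" "finite H" "H \<noteq> {}" "H \<noteq> N" using sidesD[OF less.prems(1)] by auto
  show ?case
  proof (cases "card H = 1")
    case True
    then obtain c where "H = {c}" by (auto simp: card_1_singleton_iff)
    moreover from this have "X = H" if "c \<in> X" "X \<subseteq> H" for X using that by auto
    ultimately show ?thesis using less.prems(2) by blast
  next
    case False
    moreover have "card H \<noteq> 0" using HN by simp
    ultimately have "2 \<le> card H" by linarith
    then obtain P where P: "vertex P" "N - H \<in> P" and HP: "H \<notin> P"
      using vertex_exists less.prems(1) by blast
    \<comment> \<open>When the induction hypothesis for a branch \<open>B\<close> is lifted to
      \<open>H\<close>, the only new side inside \<open>H\<close> that meets \<open>B\<close> is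
      therefore \<open>H\<close> itself.\<close>
    have up: "X = H \<or> X \<subseteq> B" if X: "X \<in> sides" "X \<subseteq> H" and B: "B \<in> P" "X \<inter> B \<noteq> {}" for X B
    proof -
      obtain C where C: "C \<in> P" "X \<subseteq> C \<or> N - X \<subseteq> C" using P X unfolding vertex_def by blast
      show ?thesis
      proof (cases "X \<subseteq> C")
        case True
        then have "C = B" using vertex_block_unique[OF P(1) C(1) B(1)] B(2) by blast
        with True show ?thesis by simp
      next
        case False
        obtain y where "y \<in> N - H" using HN by blast
        then have "C = N - H"
          using vertex_block_unique[OF P(1) C(1) P(2), of y] C(2) False X(2) by blast
        then have "N - X \<subseteq> N - H" using C(2) False by blast
        then show ?thesis using X(2) HN by blast
      qed
    qed
    show ?thesis
    proof (cases "\<exists>j l. {j, l} \<in># \<rho> \<and> j \<in> H \<and> l \<in> H \<and> apart P j l")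
      case True
      then obtain j l where jl: "{j, l} \<in># \<rho>" "j \<in> H" "l \<in> H" "apart P j l" by blast
      have "X = H" if "X \<in> sides" "X \<subseteq> H" "j \<in> X" "l \<in> X" for X
      proof -
        obtain B where B: "B \<in> P" "j \<in> B" using vertex_block[OF P(1), of j] jl(2) HN by blast
        then have "X = H \<or> X \<subseteq> B" using up[OF that(1,2) B(1)] that(3) by blast
        moreover have "\<not> X \<subseteq> B" using jl(4) B that(3,4) by (auto simp: apart_def)
        ultimately show ?thesis by blast
      qed
      moreover have "{j, l} \<in> [N]\<^bsup>2\<^esup>" using assms(1) jl(1) unfolding dominated_def by blast
      then have "j \<noteq> l" by simp
      ultimately show ?thesis using jl less.prems(2) by blast
    next
      case False
      have part: "partition_on N P" using P(1) by (simp add: vertex_def)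
      have sub: "set_mset \<rho> \<subseteq> [N]\<^bsup>2\<^esup>" "set_mset \<tau> \<subseteq> [N]\<^bsup>2\<^esup>" using assms(1) by (auto simp: dominated_def)
      \<comment> \<open>No path of \<open>\<rho>\<close> turns at the vertex within
        \<open>H\<close>, so the branch loads of \<open>\<rho>\<close> inside \<open>H\<close> add
        up to the load of \<open>H\<close>. For \<open>\<tau>\<close> they add up to at least that,
        and the slack of \<open>H\<close> is passed on to some branch.\<close>
      have "load \<rho> (N - H) = (\<Sum>B\<in>P - {N - H}. load \<rho> B)"
      proof (rule load_block_sum(2)[OF part finite_vertex[OF P(1)] P(2) sub(1)])
        fix p assume p: "p \<in># \<rho>"
        then obtain j l where jl: "p = {j, l}" "j \<in> N" "l \<in> N" using sub by (auto elim!: nsets2_E)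
        show "(\<exists>B\<in>P. p \<subseteq> B) \<or> crosses p (N - H)"
        proof (cases "j \<in> H \<and> l \<in> H")
          case True
          then have "\<not> apart P j l" using False p jl(1) by blast
          then show ?thesis by (auto simp: apart_def jl(1))
        next
          case False
          then have "crosses p (N - H) \<or> p \<subseteq> N - H" using jl(2,3) unfolding jl(1) by auto
          then show ?thesis using P(2) by blast
        qed
      qed
      moreover have "load \<tau> (N - H) \<le> (\<Sum>B\<in>P - {N - H}. load \<tau> B)"
        by (rule load_block_sum(1)[OF part finite_vertex[OF P(1)] P(2) sub(2)])
      ultimately have "(\<Sum>B\<in>P - {N - H}. load \<rho> B) < (\<Sum>B\<in>P - {N - H}. load \<tau> B)"
        using less.prems(2) load_compl[OF sub(1) HN(1)] load_compl[OF sub(2) HN(1)] by linarith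
      then obtain B where B: "B \<in> P - {N - H}" "load \<rho> B < load \<tau> B"
        by (meson not_less sum_mono)
      have BH: "B \<in> sides" "B \<subset> H"
      proof -
        show B': "B \<in> sides" using B(1) P(1) by (auto simp: vertex_def)
        have "B \<inter> (N - H) = {}" using vertex_block_unique[OF P(1) _ P(2), of B] B(1) by blast
        then have "B \<subseteq> H" using sidesD(1)[OF B'] by blast
        moreover have "B \<noteq> H" using HP B(1) by blast
        ultimately show "B \<subset> H" by blast
      qed
      then have "card B < card H" using HN psubset_card_mono by blast
      from less.hyps[OF this BH(1) B(2)] show ?thesis
      proof (elim disjE bexE conjE)
        fix c assume c: "c \<in> B" "\<forall>X\<in>sides. c \<in> X \<longrightarrow> X \<subseteq> B \<longrightarrow> load \<rho> X < load \<tau> X"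
        have "load \<rho> X < load \<tau> X" if "X \<in> sides" "c \<in> X" "X \<subseteq> H" for X
          using up[OF that(1,3), of B] B(1) c that less.prems(2) by blast
        then show ?thesis using c(1) BH(2) by blast
      next
        fix j l assume jl: "j \<in> B" "l \<in> B" "j \<noteq> l" "{j, l} \<in># \<rho>"
          "\<forall>X\<in>sides. j \<in> X \<longrightarrow> l \<in> X \<longrightarrow> X \<subseteq> B \<longrightarrow> load \<rho> X < load \<tau> X"
        have "load \<rho> X < load \<tau> X" if "X \<in> sides" "j \<in> X" "l \<in> X" "X \<subseteq> H" for X
          using up[OF that(1,4), of B] B(1) jl that less.prems(2) by blast
        then show ?thesis using jl BH(2) by blast
      qed
    qed
  qed
qed

lemma mset_pairE:
  assumes "p \<in># \<rho>" "p' \<in># \<rho>" "p \<noteq> p'"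
  obtains R where "\<rho> = R + {#p, p'#}"
proof -
  obtain R where "\<rho> = add_mset p R" using assms(1) by (metis mset_add)
  moreover from this have "p' \<in># R" using assms(2,3) by auto
  then obtain R' where "R = add_mset p' R'" by (metis mset_add)
  ultimately show thesis using that[of R'] by simp
qed

text \<open>The complement of \<open>X\<close> contains \<open>x\<close> and \<open>y\<close> and so
  fits into no branch. Hence \<open>X\<close> lies in a branch, which can only be
  \<open>B\<close>.\<close>

lemma vertex_maximal:
  assumes P: "vertex P" "B \<in> P" and xy: "apart P x y" "x \<notin> B" "y \<notin> B" "x \<in> N" "y \<in> N"
    and X: "X \<in> sides" "B \<subseteq> X" "x \<notin> X" "y \<notin> X"
  shows "X = B"
proof -
  obtain C where C: "C \<in> P" "X \<subseteq> C \<or> N - X \<subseteq> C" using P X(1) unfolding vertex_def by blast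
  show ?thesis
  proof (cases "X \<subseteq> C")
    case True
    obtain z where "z \<in> B" using sidesD(2)[of B] P unfolding vertex_def by blast
    then have "B = C" using vertex_block_unique[OF P C(1), of z] True X(2) by blast
    with True X(2) show ?thesis by blast
  next
    case False
    then have "x \<in> C" "y \<in> C" using C(2) xy X by blast+
    with xy(1) C(1) show ?thesis by (auto simp: apart_def)
  qed
qed

lemma progress_augment:
  assumes dom: "dominated \<rho> \<tau>" and P: "vertex P" "H \<in> P" and slack: "load \<rho> H < load \<tau> H"
    and ab: "{a, b} \<in># \<rho>" "apart P a b" "a \<notin> H" "b \<notin> H"
  shows "progress \<rho> \<tau>"
proof -
  have sub: "set_mset \<rho> \<subseteq> [N]\<^bsup>2\<^esup>" "set_mset \<tau> \<subseteq> [N]\<^bsup>2\<^esup>" using dom by (auto simp: dominated_def)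
  have H: "H \<in> sides" using P by (auto simp: vertex_def)
  note H = H sidesD(1)[OF H]
  have "{a, b} \<in> [N]\<^bsup>2\<^esup>" using sub ab(1) by blast
  then have abN: "a \<in> N" "b \<in> N" "a \<noteq> b" by auto
  \<comment> \<open>Edges between the path and a leaf \<open>c\<close> of \<open>H\<close> all lie
    in the branch \<open>H\<close>, the region in which \<open>descend\<close> guarantees
    slack.\<close>
  have below: "X \<subseteq> H" if X: "X \<in> sides" "a \<notin> X" "b \<notin> X" "c \<in> X" "c \<in> H" for X c
  proof -
    have "X \<union> H \<noteq> N" using abN(1) X(2) ab(3) by blast
    then have "X \<subseteq> H \<or> H \<subseteq> X" using sides_compatible[OF X(1) H(1)] X(4,5) by blast
    then show ?thesis using vertex_maximal[OF P ab(2-4) abN(1,2) X(1) _ X(2,3)] by blast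
  qed
  have compl: "load \<rho> X < load \<tau> X" if X: "X \<in> sides" "load \<rho> (N - X) < load \<tau> (N - X)" for X
    using X load_compl[OF sub(1) sidesD(1)[OF X(1)]] load_compl[OF sub(2) sidesD(1)[OF X(1)]] by simp
  from descend[OF dom H(1) slack] show ?thesis
  proof (elim disjE bexE conjE)
    fix c assume c: "c \<in> H" "\<forall>X\<in>sides. c \<in> X \<longrightarrow> X \<subseteq> H \<longrightarrow> load \<rho> X < load \<tau> X"
    have cN: "c \<in> N" "distinct [a, b, c]" using c(1) H(2) abN ab by auto
    obtain R where R: "\<rho> = R + {#{a, b}#}" using ab(1) by (metis mset_add union_mset_add_mset_right add.right_neutral)
    \<comment> \<open>The edges separating \<open>c\<close> from the whole path, given by either of
      their sides; \<open>compl\<close> reduces the second orientation to the first.\<close>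
    define inc where "inc X \<longleftrightarrow> c \<in> X \<and> a \<notin> X \<and> b \<notin> X \<or> c \<notin> X \<and> a \<in> X \<and> b \<in> X" for X
    show ?thesis
    proof (rule progress_increase[OF dom _ _ _ _ H(1), of "R + {#{a, c}, {c, b}#}" inc])
      show "transform n S \<rho> (R + {#{a, c}, {c, b}#})"
        unfolding R using abN cN by (intro transform.detour) (auto simp: N_def)
      show "set_mset (R + {#{a, c}, {c, b}#}) \<subseteq> [N]\<^bsup>2\<^esup>" using sub(1) abN cN by (auto simp: R)
      show "load (R + {#{a, c}, {c, b}#}) X = load \<rho> X + 2 * of_bool (inc X)" for X
        by (auto simp: R inc_def)
      show "inc H" using c(1) ab(3,4) by (simp add: inc_def)
      show "load \<rho> X < load \<tau> X" if X: "X \<in> sides" "inc X" for X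
      proof (cases "c \<in> X")
        case True
        then show ?thesis using X below[OF X(1) _ _ True c(1)] c(2) by (auto simp: inc_def)
      next
        case False
        then have mem: "a \<notin> N - X" "b \<notin> N - X" "c \<in> N - X" using X(2) cN(1) by (auto simp: inc_def)
        have "N - X \<subseteq> H" by (rule below[OF sides_compl[OF X(1)] mem c(1)])
        then show ?thesis using c(2) mem sides_compl[OF X(1)] by (intro compl[OF X(1)]) simp
      qed
    qed
  next
    fix j l assume jl: "j \<in> H" "l \<in> H" "j \<noteq> l" "{j, l} \<in># \<rho>"
      "\<forall>X\<in>sides. j \<in> X \<longrightarrow> l \<in> X \<longrightarrow> X \<subseteq> H \<longrightarrow> load \<rho> X < load \<tau> X"
    have jlN: "j \<in> N" "l \<in> N" "distinct [a, j, l, b]" using jl H(2) abN ab by auto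
    have "{a, b} \<noteq> {j, l}" using jl(1,2) ab(3) by auto
    then obtain R where R: "\<rho> = R + {#{a, b}, {j, l}#}" using mset_pairE[OF ab(1) jl(4)] by blast
    define inc where "inc X \<longleftrightarrow> j \<in> X \<and> l \<in> X \<and> a \<notin> X \<and> b \<notin> X \<or> j \<notin> X \<and> l \<notin> X \<and> a \<in> X \<and> b \<in> X" for X
    show ?thesis
    proof (rule progress_increase[OF dom _ _ _ _ H(1), of "R + {#{a, j}, {b, l}#}" inc])
      \<comment> \<open>The edge \<open>H\<close> separates the two paths, which is why the exchange
        of the second kind applies.\<close>
      have "resolved a b j l"
        using sides_resolved[OF H(1), of j l a b] jl jlN abN ab by (auto simp: resolved_sym)
      moreover have "{a, j, b, l} = {a, b, j, l}" by auto
      ultimately have "splits {a, j, b, l} \<inter> S = {{{a, b}, {j, l}}}" by (simp add: resolved_def)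
      then show "transform n S \<rho> (R + {#{a, j}, {b, l}#})"
        unfolding R using jlN by (intro transform.exchange_only) auto
      show "set_mset (R + {#{a, j}, {b, l}#}) \<subseteq> [N]\<^bsup>2\<^esup>" using sub(1) abN jlN by (auto simp: R)
      show "load (R + {#{a, j}, {b, l}#}) X = load \<rho> X + 2 * of_bool (inc X)" if X: "X \<in> sides" for X
      proof -
        have "X \<subseteq> H \<or> H \<subseteq> X \<or> X \<inter> H = {} \<or> X \<union> H = N" by (rule sides_compatible[OF X H(1)])
        then have "\<not> (a \<in> X \<and> j \<in> X \<and> b \<notin> X \<and> l \<notin> X)" "\<not> (a \<in> X \<and> l \<in> X \<and> b \<notin> X \<and> j \<notin> X)"
          "\<not> (b \<in> X \<and> j \<in> X \<and> a \<notin> X \<and> l \<notin> X)" "\<not> (b \<in> X \<and> l \<in> X \<and> a \<notin> X \<and> j \<notin> X)"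
          using jl(1,2) ab(3,4) abN by blast+
        then show ?thesis by (auto simp: R inc_def)
      qed
      show "inc H" using jl(1,2) ab(3,4) by (simp add: inc_def)
      show "load \<rho> X < load \<tau> X" if X: "X \<in> sides" "inc X" for X
      proof (cases "j \<in> X")
        case True
        then show ?thesis using X below[OF X(1) _ _ True jl(1)] jl(5) by (auto simp: inc_def)
      next
        case False
        then have mem: "a \<notin> N - X" "b \<notin> N - X" "j \<in> N - X" "l \<in> N - X"
          using X(2) jlN by (auto simp: inc_def)
        have "N - X \<subseteq> H" by (rule below[OF sides_compl[OF X(1)] mem(1-3) jl(1)])
        then show ?thesis using jl(5) mem sides_compl[OF X(1)] by (intro compl[OF X(1)]) simp
      qed
    qed
  qed
qed

text \<open>At the inner vertex where the paths from \<open>a\<close> to \<open>b\<close> and to \<open>c\<close> part, the path \<open>{a, b}\<close> is switched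
  to the branch \<open>F\<close> of \<open>c\<close>. This is blocked only if \<open>F\<close> is unused by \<open>\<rho>\<close> or if every path of \<open>\<rho>\<close>
  through the vertex uses the branch \<open>E\<close> of \<open>b\<close>; comparing loads with \<open>\<tau>\<close>, some branch then has
  slack.\<close>
lemma progress_step:
  assumes "dominated \<rho> \<tau>" "{a, b} \<in># \<rho>" "{a, c} \<in># \<tau>"
    and "G \<in> sides" "a \<notin> G" "b \<in> G" "c \<in> G"
  shows "progress \<rho> \<tau>"
  using assms
\<comment> \<open>\<open>G\<close> is an edge shared by the paths from \<open>a\<close> to
  \<open>b\<close> and to \<open>c\<close>. Passing to smaller shared edges ends with
  \<open>b = c\<close>, a pair common to both families. \<open>\<rho>\<close> and \<open>b\<close>
  vary because exchanges alter them.\<close>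
proof (induction "card G" arbitrary: \<rho> b G rule: less_induct)
  case less
  note dom = less.prems(1) and ab = less.prems(2) and ac = less.prems(3)
    and G = less.prems(4-7)
  have sub: "set_mset \<rho> \<subseteq> [N]\<^bsup>2\<^esup>" "set_mset \<tau> \<subseteq> [N]\<^bsup>2\<^esup>" using dom by (auto simp: dominated_def)
  have GN: "G \<subseteq> N" "finite G" using sidesD[OF G(1)] by auto
  have "{a, b} \<in> [N]\<^bsup>2\<^esup>" using sub ab by blast
  then have abN: "a \<in> N" "b \<in> N" "a \<noteq> b" by auto
  show ?case
  proof (cases "b = c")
    case True
    then show ?thesis unfolding progress_def using dom ab ac by blast
  next
    case False
    then have "card {b, c} \<le> card G" using G GN(2) by (intro card_mono) auto
    then have "2 \<le> card G" using False by simp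
    then obtain P where P: "vertex P" "N - G \<in> P" "G \<notin> P" using vertex_exists G(1) by blast
    have block: "B \<in> sides" "B \<subset> G" "card B < card G" if B: "B \<in> P" "B \<noteq> N - G" for B
    proof -
      show B': "B \<in> sides" using B(1) P(1) by (auto simp: vertex_def)
      have "B \<inter> (N - G) = {}" using vertex_block_unique[OF P(1) B(1) P(2)] B(2) by blast
      then have "B \<subseteq> G" using sidesD(1)[OF B'] by blast
      moreover have "B \<noteq> G" using P(3) B(1) by blast
      ultimately show "B \<subset> G" by blast
      then show "card B < card G" using GN(2) psubset_card_mono by blast
    qed
    obtain E F where E: "E \<in> P" "b \<in> E" and F: "F \<in> P" "c \<in> F"
      using vertex_block[OF P(1)] G GN(1) by blast
    have EG: "E \<noteq> N - G" and FG: "F \<noteq> N - G" using E F G by blast+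
    have aEF: "a \<notin> E" "a \<notin> F" using block(2)[OF E(1) EG] block(2)[OF F(1) FG] G(2) by blast+
    have ap: "apart P a b" using apart_blocks[OF P(1,2), of a b] G abN by blast
    show ?thesis
    proof (cases "E = F")
      case True
      show ?thesis
        by (rule less.hyps[OF block(3)[OF F(1) FG] dom ab ac block(1)[OF F(1) FG]])
          (use aEF E F True in auto)
    next
      case False
      then have bF: "b \<notin> F" using vertex_block_unique[OF P(1) E(1) F(1) E(2)] by blast
      \<comment> \<open>Exchanging \<open>{a, b}, {l, j}\<close> for \<open>{a, l}, {b, j}\<close>
        gives \<open>a\<close> a partner in the branch of \<open>c\<close>, and the induction
        continues with \<open>F\<close>. The claim is stated for all \<open>\<rho>\<close> since it
        is also applied after a preliminary exchange.\<close>
      have switch: "progress \<rho> \<tau>"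
        if dom: "dominated \<rho> \<tau>" and ab: "{a, b} \<in># \<rho>" and lj: "{l, j} \<in># \<rho>" "l \<in> F" "j \<notin> F" "j \<notin> E"
        for \<rho> l j
      proof -
        have "{l, j} \<in> [N]\<^bsup>2\<^esup>" using dom lj(1) unfolding dominated_def by blast
        then have ljN: "l \<in> N" "j \<in> N" "l \<noteq> j" by auto
        show ?thesis
        proof (cases "j = a")
          case True
          then have "{a, l} \<in># \<rho>" using lj(1) by (simp add: insert_commute)
          from less.hyps[OF block(3)[OF F(1) FG] dom this ac block(1)[OF F(1) FG] aEF(2) lj(2) F(2)]
          show ?thesis .
        next
          case False
          have dist: "distinct [a, b, l, j]" using abN ljN lj E F aEF bF False by auto
          then have "{a, b} \<noteq> {l, j}" by auto
          then obtain R where R: "\<rho> = R + {#{a, b}, {l, j}#}" using mset_pairE[OF ab lj(1)] by blast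
          have "is_split l b a j"
          proof (rule apart_exchange[OF P(1) dist _ ap])
            show "apart P l j" by (rule apart_blocks[OF P(1) F(1) lj(2,3)])
            show "apart P b j" by (rule apart_blocks[OF P(1) E lj(4)])
            show "apart P a l" using apart_blocks[OF P(1) F(1) lj(2) aEF(2)] by (simp add: apart_sym)
            show "{a, b, l, j} \<subseteq> N" using abN ljN by simp
          qed
          note ex = exchange_dominated[OF dom[unfolded R] dist this] exchange_step[OF dist this, of R]
          have "progress (R + {#{a, l}, {b, j}#}) \<tau>"
            by (rule less.hyps[OF block(3)[OF F(1) FG] ex(1) _ ac block(1)[OF F(1) FG] aEF(2) lj(2) F(2)]) simp
          then show ?thesis using progress_transform[OF ex(3,2)] by (simp add: R)
        qed
      qed
      have pairN: "x \<in> N" "y \<in> N" "x \<noteq> y" if "{x, y} \<in># \<rho>" for x y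
      proof -
        have "{x, y} \<in> [N]\<^bsup>2\<^esup>" using sub that by blast
        then show "x \<in> N" "y \<in> N" "x \<noteq> y" by auto
      qed
      consider (outside) l j where "{l, j} \<in># \<rho>" "l \<in> F" "j \<notin> F" "j \<notin> E"
        | (unused) "\<And>l j. {l, j} \<in># \<rho> \<Longrightarrow> l \<in> F \<Longrightarrow> j \<in> F"
        | (through) l j where "{l, j} \<in># \<rho>" "l \<in> F" "j \<in> E"
        by blast
      then show ?thesis
      proof cases
        case outside
        then show ?thesis using switch dom ab by blast
      next
        \<comment> \<open>\<open>{a, c}\<close> loads \<open>F\<close> in \<open>\<tau>\<close>
          while \<open>\<rho>\<close> does not, so \<open>F\<close> has slack, and the path from
          \<open>a\<close> to \<open>b\<close> avoids it.\<close>
        case unused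
        have "\<not> 0 < load \<rho> F"
        proof
          assume "0 < load \<rho> F"
          then obtain p where p: "p \<in># \<rho>" "crosses p F" by (auto simp: load_pos_iff)
          then have "p \<in> [N]\<^bsup>2\<^esup>" using sub by blast
          then obtain x y where "p = {x, y}" by (auto elim: nsets2_E)
          then show False using p unused[of x y] unused[of y x] by (auto simp: insert_commute)
        qed
        moreover have "0 < load \<tau> F"
          unfolding load_pos_iff using ac aEF(2) F(2) by (intro exI[of _ "{a, c}"]) simp
        ultimately have "load \<rho> F < load \<tau> F" by simp
        then show ?thesis using progress_augment[OF dom P(1) F(1) _ ab ap aEF(2) bF] by blast
      next
        case (through l j)
        have ljN: "l \<in> N" "j \<in> N" "l \<noteq> j" using pairN through(1) by auto
        have lE: "l \<notin> E" and jF: "j \<notin> F"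
          using vertex_block_unique[OF P(1) E(1) F(1)] False through by blast+
        have ap_lj: "apart P l j" by (rule apart_blocks[OF P(1) F(1) through(2) jF])
        show ?thesis
        proof (cases "\<exists>x y. {x, y} \<in># \<rho> \<and> apart P x y \<and> x \<notin> E \<and> y \<notin> E")
          case True
          then obtain x y where xy: "{x, y} \<in># \<rho>" "apart P x y" "x \<notin> E" "y \<notin> E" by blast
          note xyN = pairN[OF xy(1)]
          consider "x \<in> F" "y \<notin> F" | "y \<in> F" "x \<notin> F" | "x \<notin> F" "y \<notin> F"
            using xy(2) F(1) by (auto simp: apart_def)
          then show ?thesis
          proof cases
            case 1
            then show ?thesis using switch[OF dom ab xy(1)] xy by blast
          next
            case 2
            then show ?thesis using switch[OF dom ab, of y x] xy by (simp add: insert_commute)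
          next
            \<comment> \<open>A path avoiding both \<open>E\<close> and \<open>F\<close> first
              exchanges ends with \<open>{l, j}\<close>. This yields a pair from \<open>F\<close> to
              a leaf outside \<open>E\<close>, and \<open>{a, b}\<close> is still there for
              \<open>switch\<close>.\<close>
            case 3
            have dist: "distinct [l, j, x, y]" using ljN xyN 3 xy through by auto
            have "{l, j} \<noteq> {x, y}" using dist by auto
            then obtain R where R: "\<rho> = R + {#{l, j}, {x, y}#}" using mset_pairE[OF through(1) xy(1)] by blast
            have "is_split x j l y"
            proof (rule apart_exchange[OF P(1) dist _ ap_lj xy(2)])
              show "apart P l x" by (rule apart_blocks[OF P(1) F(1) through(2) 3(1)])
              show "apart P j y" by (rule apart_blocks[OF P(1) E(1) through(3) xy(4)])
              show "{l, j, x, y} \<subseteq> N" using ljN xyN by simp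
            qed
            note ex = exchange_dominated[OF dom[unfolded R] dist this] exchange_step[OF dist this, of R]
            have "{a, b} \<noteq> {l, j}" "{a, b} \<noteq> {x, y}" using E(2) xy(3,4) bF aEF through(2) lE by auto
            then have "{a, b} \<in># R" using ab by (simp add: R)
            then have "progress (R + {#{l, x}, {j, y}#}) \<tau>"
              using switch[OF ex(1), of l x] through(2) 3 xy by simp
            then show ?thesis using progress_transform[OF ex(3,2)] by (simp add: R)
          qed
        next
          case no_other: False
          have part: "partition_on N P" using P(1) by (simp add: vertex_def)
          have "load \<rho> E = (\<Sum>B\<in>P - {E}. load \<rho> B)"
          proof (rule load_block_sum(2)[OF part finite_vertex[OF P(1)] E(1) sub(1)])
            fix p assume p: "p \<in># \<rho>"
            then have "p \<in> [N]\<^bsup>2\<^esup>" using sub by blast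
            then obtain x y where xy: "p = {x, y}" by (auto elim: nsets2_E)
            show "(\<exists>B\<in>P. p \<subseteq> B) \<or> crosses p E"
            proof (cases "apart P x y")
              case True
              then have "x \<in> E \<or> y \<in> E" "\<not> (x \<in> E \<and> y \<in> E)"
                using no_other p E(1) by (auto simp: xy apart_def)
              then show ?thesis by (auto simp: xy)
            qed (auto simp: apart_def xy)
          qed
          \<comment> \<open>In \<open>\<rho>\<close> every path through the vertex uses
            \<open>E\<close>, but \<open>{a, c}\<close> in \<open>\<tau>\<close> does not; the
            strict gap puts slack on a branch other than \<open>E\<close>.\<close>
          moreover have "load \<tau> E < (\<Sum>B\<in>P - {E}. load \<tau> B)"
          proof (rule load_block_sum(3)[OF part finite_vertex[OF P(1)] E(1) sub(2) ac])
            show "\<not> (\<exists>B\<in>P. {a, c} \<subseteq> B)"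
              using apart_blocks[OF P(1) F aEF(2)] by (auto simp: apart_def)
            have "c \<notin> E" using vertex_block_unique[OF P(1) E(1) F(1)] F(2) False by blast
            then show "\<not> crosses {a, c} E" using aEF by simp
          qed
          moreover have "load \<rho> E \<le> load \<tau> E" using dom block(1)[OF E(1) EG] by (simp add: dominated_def)
          ultimately have "(\<Sum>B\<in>P - {E}. load \<rho> B) < (\<Sum>B\<in>P - {E}. load \<tau> B)" by linarith
          then obtain B where B: "B \<in> P - {E}" "load \<rho> B < load \<tau> B" by (meson not_less sum_mono)
          show ?thesis
          \<comment> \<open>The path to be augmented must avoid the branch with slack. The branch of
            \<open>a\<close> is used by \<open>{a, b}\<close>, so there \<open>{l, j}\<close> takes
            over.\<close>
          proof (cases "B = N - G")
            case True
            have "l \<in> G" "j \<in> G" using block(2)[OF E(1) EG] block(2)[OF F(1) FG] through by blast+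
            then show ?thesis
              using progress_augment[OF dom P(1) _ B(2) through(1) ap_lj] B(1) True by blast
          next
            case False
            then have "a \<notin> B" using block(2)[of B] B(1) G(2) by blast
            moreover have "b \<notin> B" using vertex_block_unique[OF P(1) E(1) _ E(2), of B] B(1) by blast
            ultimately show ?thesis using progress_augment[OF dom P(1) _ B(2) ab ap] B(1) by blast
          qed
        qed
      qed
    qed
  qed
qed

text \<open>The recursion stops only when \<open>\<rho>\<close> is exhausted, so part of
  \<open>\<tau>\<close> may remain unmatched. A common pair is cancelled, and restored afterwards as
  a passive part of the family.\<close>

theorem dominated_reach:
  assumes "dominated \<rho> \<tau>"
  shows "\<exists>\<tau>'. \<tau>' \<subseteq># \<tau> \<and> reach \<rho> \<tau>'"
  using assms
proof (induction "slack \<rho> \<tau> + size \<tau>" arbitrary: \<rho> \<tau> rule: less_induct)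
  case less
  note dom = less.prems
  have sub: "set_mset \<rho> \<subseteq> [N]\<^bsup>2\<^esup>" "set_mset \<tau> \<subseteq> [N]\<^bsup>2\<^esup>" using dom by (auto simp: dominated_def)
  show ?case
  proof (cases "\<rho> = {#}")
    case True
    then show ?thesis by (intro exI[of _ "{#}"]) simp
  next
    case False
    then obtain p where p: "p \<in># \<rho>" by blast
    then have "p \<in> [N]\<^bsup>2\<^esup>" using sub by blast
    then obtain a b where ab: "p = {a, b}" "a \<in> N" "b \<in> N" "a \<noteq> b" by (auto elim: nsets2_E)
    have A: "{a} \<in> sides" using ab by (intro sides_singleton) auto
    have "0 < load \<rho> {a}" unfolding load_pos_iff using p ab by (intro exI[of _ p]) auto
    moreover have "load \<rho> {a} \<le> load \<tau> {a}" using dom A by (simp add: dominated_def)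
    ultimately have "0 < load \<tau> {a}" by linarith
    then obtain p' where p': "p' \<in># \<tau>" "crosses p' {a}" by (auto simp: load_pos_iff)
    then have "p' \<in> [N]\<^bsup>2\<^esup>" using sub by blast
    then obtain x y where xy: "p' = {x, y}" "x \<in> N" "y \<in> N" by (auto elim: nsets2_E)
    with p' obtain c where c: "{a, c} \<in># \<tau>" "c \<in> N" "c \<noteq> a" by (auto simp: insert_commute)
    \<comment> \<open>The pendant edge at \<open>a\<close> is loaded by \<open>\<rho>\<close>, hence
      by \<open>\<tau>\<close>, which supplies \<open>c\<close>. Seen from \<open>a\<close>, that
      edge is the first one shared by both paths.\<close>
    have "progress \<rho> \<tau>"
      by (rule progress_step[OF dom p[unfolded ab(1)] c(1) sides_compl[OF A]]) (use ab c in auto)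
    then obtain \<rho>' where \<rho>': "reach \<rho> \<rho>'" "dominated \<rho>' \<tau>"
      and cases: "slack \<rho>' \<tau> < slack \<rho> \<tau> \<or> slack \<rho>' \<tau> = slack \<rho> \<tau> \<and> (\<exists>p. p \<in># \<rho>' \<and> p \<in># \<tau>)"
      unfolding progress_def by blast
    from cases show ?thesis
    proof (elim disjE conjE exE)
      assume "slack \<rho>' \<tau> < slack \<rho> \<tau>"
      then obtain \<tau>' where "\<tau>' \<subseteq># \<tau>" "reach \<rho>' \<tau>'" using less.hyps[OF _ \<rho>'(2)] by auto
      then show ?thesis using \<rho>'(1) by (meson rtranclp_trans)
    next
      fix p assume eq: "slack \<rho>' \<tau> = slack \<rho> \<tau>" and p: "p \<in># \<rho>'" "p \<in># \<tau>"
      obtain R T where RT: "\<rho>' = add_mset p R" "\<tau> = add_mset p T" using p by (metis mset_add)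
      have "dominated R T" using \<rho>'(2) unfolding dominated_def RT by (auto simp del: crosses_pair)
      moreover have "slack R T = slack \<rho>' \<tau>" unfolding slack_def RT by simp
      ultimately obtain \<tau>' where \<tau>': "\<tau>' \<subseteq># T" "reach R \<tau>'" using less.hyps[of R T] eq RT(2) by auto
      have "reach ({#p#} + R) ({#p#} + \<tau>')" by (rule transform_rtranclp_add[OF \<tau>'(2)])
      then have "reach \<rho> (add_mset p \<tau>')" using \<rho>'(1) unfolding RT by (simp add: rtranclp_trans)
      moreover have "add_mset p \<tau>' \<subseteq># \<tau>" using \<tau>'(1) unfolding RT by simp
      ultimately show ?thesis by blast
    qed
  qed
qed

end

section \<open>Feasible edge weights\<close>

lemma sum_mset_strict_mono:
  fixes f g :: "'a \<Rightarrow> real"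
  assumes "A \<noteq> {#}" "\<And>x. x \<in># A \<Longrightarrow> f x < g x"
  shows "(\<Sum>x\<in>#A. f x) < (\<Sum>x\<in>#A. g x)"
  using assms
proof (induction A)
  case (add x A)
  then show ?case by (cases "A = {#}") (auto intro!: add_strict_mono)
qed simp

context quartet_system
begin

text \<open>Leaf 1 serves as the root, so that every edge is represented by its side away from 1.\<close>
definition clusters :: "nat set set" where
  "clusters = {X \<in> sides. 1 \<notin> X}"

lemma finite_clusters: "finite clusters"
  using finite_sides by (simp add: clusters_def)

lemma clusters_or_compl:
  assumes "X \<in> sides"
  shows "X \<in> clusters \<or> N - X \<in> clusters"
  using assms sides_compl by (auto simp: clusters_def)

text \<open>The unknowns are the edge weights; positivity and the two bounds for each pair form one
  strict system, whose certificates of infeasibility are refuted.\<close>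

theorem weights_exist:
  fixes m M :: "nat set \<Rightarrow> real"
  assumes M_pos: "\<And>I. I \<in> [N]\<^bsup>2\<^esup> \<Longrightarrow> 0 < M I"
    and less: "\<And>\<sigma> \<tau>. \<sigma> \<noteq> {#} \<Longrightarrow> set_mset \<sigma> \<subseteq> [N]\<^bsup>2\<^esup> \<Longrightarrow> set_mset \<tau> \<subseteq> [N]\<^bsup>2\<^esup> \<Longrightarrow> reach \<sigma> \<tau> \<Longrightarrow>
      (\<Sum>I\<in>#\<sigma>. m I) < (\<Sum>I\<in>#\<tau>. M I)"
  shows "\<exists>w. (\<forall>X\<in>clusters. 0 < w X) \<and>
    (\<forall>p\<in>[N]\<^bsup>2\<^esup>. (\<Sum>X\<in>clusters. of_bool (crosses p X) * w X) \<in> {m p<..<M p})"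
proof -
  define C :: "((nat set \<Rightarrow> int) \<times> real) set" where
    "C = (\<lambda>Y. (\<lambda>X. - of_bool (X = Y), 0)) ` clusters \<union>
      (\<lambda>p. (\<lambda>X. of_bool (crosses p X), M p)) ` [N]\<^bsup>2\<^esup> \<union>
      (\<lambda>p. (\<lambda>X. - of_bool (crosses p X), - m p)) ` [N]\<^bsup>2\<^esup>"
  have "finite C"
    unfolding C_def using finite_clusters finite_imp_finite_nsets[OF finite_N] by simp
  \<comment> \<open>A certificate unfolds into the lower bounds used (\<open>\<sigma>\<close>), the
    upper bounds used (\<open>\<tau>\<close>) and the multiplicities \<open>y\<close> of the
    positivity constraints. The last clause remembers that the combination is not empty. Where all
    coefficients vanish, the load of \<open>\<tau>\<close> is that of \<open>\<sigma>\<close> plus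
    \<open>y\<close>.\<close>
  define rep where "rep c \<sigma> \<tau> y \<longleftrightarrow> set_mset \<sigma> \<subseteq> [N]\<^bsup>2\<^esup> \<and> set_mset \<tau> \<subseteq> [N]\<^bsup>2\<^esup> \<and>
      (\<forall>X. fst c X = int (load \<tau> X) - int (load \<sigma> X) - int (y X)) \<and>
      snd c = (\<Sum>I\<in>#\<tau>. M I) - (\<Sum>I\<in>#\<sigma>. m I) \<and>
      (\<sigma> \<noteq> {#} \<or> \<tau> \<noteq> {#} \<or> (\<exists>X\<in>clusters. y X \<noteq> 0))"
    for c :: "(nat set \<Rightarrow> int) \<times> real" and \<sigma> \<tau> and y :: "nat set \<Rightarrow> nat"
  have repr: "\<exists>\<sigma> \<tau> y. rep c \<sigma> \<tau> y"
    if "c \<in> cone C" for c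
    using that
  proof induction
    case (gen c)
    then consider Y where "Y \<in> clusters" "c = (\<lambda>X. - of_bool (X = Y), 0)"
      | p where "p \<in> [N]\<^bsup>2\<^esup>" "c = (\<lambda>X. of_bool (crosses p X), M p)"
      | p where "p \<in> [N]\<^bsup>2\<^esup>" "c = (\<lambda>X. - of_bool (crosses p X), - m p)"
      by (auto simp: C_def)
    then show ?case
    proof cases
      case 1
      then show ?thesis
        by (intro exI[of _ "{#}"] exI[of _ "{#}"] exI[of _ "\<lambda>X. of_bool (X = Y)"]) (auto simp: rep_def)
    next
      case 2
      then show ?thesis
        by (intro exI[of _ "{#}"] exI[of _ "{#p#}"] exI[of _ "\<lambda>X. 0"]) (auto simp: rep_def)
    next
      case 3
      then show ?thesis
        by (intro exI[of _ "{#p#}"] exI[of _ "{#}"] exI[of _ "\<lambda>X. 0"]) (auto simp: rep_def)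
    qed
  next
    case (add a b a' b')
    then obtain \<sigma> \<tau> y \<sigma>' \<tau>' y' where "rep (a, b) \<sigma> \<tau> y" "rep (a', b') \<sigma>' \<tau>' y'" by blast
    then have "rep (\<lambda>X. a X + a' X, b + b') (\<sigma> + \<sigma>') (\<tau> + \<tau>') (\<lambda>X. y X + y' X)"
      by (auto simp: rep_def)
    then show ?case by blast
  qed
  have "\<not> (\<exists>(a, b) \<in> cone C. (\<forall>X\<in>clusters. a X = 0) \<and> b \<le> 0)"
  proof
    assume "\<exists>(a, b) \<in> cone C. (\<forall>X\<in>clusters. a X = 0) \<and> b \<le> 0"
    then obtain a b where ab: "(a, b) \<in> cone C" "\<forall>X\<in>clusters. a X = 0" "b \<le> 0" by blast
    obtain \<sigma> \<tau> y where "rep (a, b) \<sigma> \<tau> y" using repr[OF ab(1)] by blast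
    then have sub: "set_mset \<sigma> \<subseteq> [N]\<^bsup>2\<^esup>" "set_mset \<tau> \<subseteq> [N]\<^bsup>2\<^esup>"
      and eq: "\<And>X. a X = int (load \<tau> X) - int (load \<sigma> X) - int (y X)"
      and b: "b = (\<Sum>I\<in>#\<tau>. M I) - (\<Sum>I\<in>#\<sigma>. m I)"
      and ne: "\<sigma> \<noteq> {#} \<or> \<tau> \<noteq> {#} \<or> (\<exists>X\<in>clusters. y X \<noteq> 0)"
      unfolding rep_def by simp_all
    show False
    \<comment> \<open>The assumed inequality needs a nonempty \<open>\<sigma>\<close>. If it is
      empty, \<open>b \<le> 0\<close> and positive \<open>M\<close> leave only positivity
      constraints, and these cannot cancel.\<close>
    proof (cases "\<sigma> = {#}")
      case True
      have "\<tau> = {#}"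
      proof (rule ccontr)
        assume "\<tau> \<noteq> {#}"
        then have "0 < (\<Sum>I\<in>#\<tau>. M I)" using sum_mset_strict_mono[of \<tau> "\<lambda>_. 0" M] M_pos sub(2) by auto
        then show False using b ab(3) True by simp
      qed
      then obtain X where X: "X \<in> clusters" "y X \<noteq> 0" using ne True by blast
      then show False using eq[of X] ab(2) True \<open>\<tau> = {#}\<close> by simp
    next
      case False
      have le: "load \<sigma> X \<le> load \<tau> X" if "X \<in> clusters" for X
        using eq[of X] ab(2) that by simp
      have "load \<sigma> X \<le> load \<tau> X" if X: "X \<in> sides" for X
        using clusters_or_compl[OF X] le[of X] le[of "N - X"]
          load_compl[OF sub(1) sidesD(1)[OF X]] load_compl[OF sub(2) sidesD(1)[OF X]] by auto
      \<comment> \<open>All loads of the doubled families are even, so the parity clause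
        holds.\<close>
      then have "dominated (\<sigma> + \<sigma>) (\<tau> + \<tau>)"
        using sub by (auto simp: dominated_def intro: add_mono)
      then obtain \<tau>' where \<tau>': "\<tau>' \<subseteq># \<tau> + \<tau>" "reach (\<sigma> + \<sigma>) \<tau>'" using dominated_reach by blast
      obtain \<rho> where \<rho>: "\<tau> + \<tau> = \<tau>' + \<rho>" using \<tau>'(1) by (metis subset_mset.le_iff_add)
      have "set_mset (\<tau>' + \<rho>) \<subseteq> [N]\<^bsup>2\<^esup>" using sub(2) unfolding \<rho>[symmetric] by simp
      then have sub': "set_mset \<tau>' \<subseteq> [N]\<^bsup>2\<^esup>" "set_mset \<rho> \<subseteq> [N]\<^bsup>2\<^esup>" by auto
      have "(\<Sum>I\<in>#\<sigma> + \<sigma>. m I) < (\<Sum>I\<in>#\<tau>'. M I)"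
        using less[of "\<sigma> + \<sigma>" \<tau>'] False sub(1) sub' \<tau>'(2) by simp
      moreover have "0 \<le> (\<Sum>I\<in>#\<rho>. M I)"
      proof (cases "\<rho> = {#}")
        case False
        then show ?thesis using sum_mset_strict_mono[of \<rho> "\<lambda>_. 0" M] M_pos sub'(2) by force
      qed simp
      moreover have "(\<Sum>I\<in>#\<tau> + \<tau>. M I) = (\<Sum>I\<in>#\<tau>'. M I) + (\<Sum>I\<in>#\<rho>. M I)"
        unfolding \<rho> by simp
      ultimately show False using b ab(3) by simp
    qed
  qed
  then obtain w where w: "\<And>a b. (a, b) \<in> C \<Longrightarrow> (\<Sum>X\<in>clusters. real_of_int (a X) * w X) < b"
    using strict_farkas[OF finite_clusters \<open>finite C\<close>] by blast
  have "0 < w Y" if Y: "Y \<in> clusters" for Y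
  proof -
    have "(\<lambda>X. - of_bool (X = Y), 0) \<in> C" using Y by (auto simp: C_def)
    from w[OF this] have "(\<Sum>X\<in>clusters. real_of_int (- of_bool (X = Y)) * w X) < 0" .
    also have "(\<Sum>X\<in>clusters. real_of_int (- of_bool (X = Y)) * w X) =
        (\<Sum>X\<in>clusters. if X = Y then - w Y else 0)"
      by (intro sum.cong) auto
    finally show ?thesis using Y finite_clusters by simp
  qed
  moreover have "(\<Sum>X\<in>clusters. of_bool (crosses p X) * w X) \<in> {m p<..<M p}" if p: "p \<in> [N]\<^bsup>2\<^esup>" for p
  proof -
    have "(\<lambda>X. of_bool (crosses p X), M p) \<in> C" "(\<lambda>X. - of_bool (crosses p X), - m p) \<in> C"
      using p by (auto simp: C_def)
    from w[OF this(1)] w[OF this(2)] show ?thesis by (simp add: sum_negf)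
  qed
  ultimately show ?thesis by blast
qed

end

section \<open>Paths and distances in trees\<close>

definition path_weight :: "('a set \<Rightarrow> real) \<Rightarrow> ('a \<times> 'a) list \<Rightarrow> real" where
  "path_weight w p = (\<Sum>(u, v)\<leftarrow>p. w {u, v})"

lemma path_weight_simps [simp]:
  "path_weight w [] = 0" "path_weight w (e # p) = w {fst e, snd e} + path_weight w p"
  "path_weight w (p @ q) = path_weight w p + path_weight w q"
  by (auto simp: path_weight_def case_prod_beta)

lemma path_weight_rev_path [simp]: "path_weight w (rev_path p) = path_weight w p"
  by (induction p) (auto simp: insert_commute)

context pair_graph
begin

text \<open>Two distinct paths with different first arcs close up, through their common starting point,
  to a cycle.\<close>
lemma apath_unique:
  assumes acyclic: "\<not> (\<exists>p. cycle p \<and> 3 \<le> length p)"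
    and "apath u p v" "apath u q v"
  shows "p = q"
  using assms(2,3)
proof (induction p arbitrary: u q)
  case Nil
  then have "u = v" by (simp add: apath_Nil_iff)
  with Nil.prems(2) show ?case using apath_nonempty_ends by blast
next
  case (Cons e p')
  then have "u \<noteq> v" using apath_nonempty_ends by blast
  with Cons.prems(2) obtain e' q' where q: "q = e' # q'" by (cases q) (auto simp: apath_Nil_iff)
  have e: "e \<in> parcs G" "fst e = u" "apath (snd e) p' v" "u \<notin> set (awalk_verts (snd e) p')"
    using Cons.prems(1) by (auto simp: apath_Cons_iff)
  have e': "e' \<in> parcs G" "fst e' = u" "apath (snd e') q' v" "u \<notin> set (awalk_verts (snd e') q')"
    using Cons.prems(2) unfolding q by (auto simp: apath_Cons_iff)
  show ?case
  proof (cases "e = e'")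
    case True
    with Cons.IH[OF e(3)] e'(3) q show ?thesis by simp
  next
    case False
    let ?x = "snd e" and ?y = "snd e'"
    have "?x \<noteq> ?y" using False e(2) e'(2) by (metis prod.collapse)
    have walks: "awalk ?x p' v" "awalk ?y q' v" using e(3) e'(3) by (auto simp: apath_def)
    then have rev: "awalk v (rev_path q') ?y" by simp
    \<comment> \<open>This walk joins the second vertices of the two paths without visiting
      \<open>u\<close>. Made loop-free and closed up through \<open>u\<close>, it becomes a cycle,
      of length at least 3 as its ends differ.\<close>
    have walk: "awalk ?x (p' @ rev_path q') ?y" using walks(1) rev by (rule awalk_appendI)
    have "set (awalk_verts ?x (p' @ rev_path q')) = set (awalk_verts ?x p') \<union> set (awalk_verts v (rev_path q'))"
      by (rule set_awalk_verts_append[OF walks(1) rev])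
    then have u: "u \<notin> set (awalk_verts ?x (p' @ rev_path q'))"
      using e(4) e'(4) awalk_verts_rev_path[OF walks(2)] by simp
    define r where "r = awalk_to_apath (p' @ rev_path q')"
    have r: "apath ?x r ?y" unfolding r_def by (rule apath_awalk_to_apath[OF walk])
    have "set r \<subseteq> set (p' @ rev_path q')" unfolding r_def by (rule awalk_to_apath_subset[OF walk])
    moreover have "awalk ?x r ?y" using r by (simp add: apath_def)
    ultimately have "set (awalk_verts ?x r) \<subseteq> set (awalk_verts ?x (p' @ rev_path q'))"
      unfolding set_awalk_verts[OF walk] set_awalk_verts[OF \<open>awalk ?x r ?y\<close>]
      by (simp only: set_map) (intro Un_mono image_mono subset_refl)
    then have r_u: "u \<notin> set (awalk_verts ?x r)" using u by blast
    have "r \<noteq> []" using r \<open>?x \<noteq> ?y\<close> by (auto simp: apath_Nil_iff)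
    define c where "c = e # r @ [(?y, u)]"
    have rev_arc: "(?y, u) \<in> parcs G" using e'(1,2) arcs_symmetric[of u ?y] by (metis prod.collapse)
    have "u \<in> pverts G" using e(1,2) wellformed by auto
    then have back_walk: "awalk ?y [(?y, u)] u" using rev_arc by (auto simp: awalk_simps)
    have rw: "awalk ?x r ?y" using r by (simp add: apath_def)
    have tail: "awalk ?x (r @ [(?y, u)]) u" using rw back_walk by (rule awalk_appendI)
    then have "awalk u c u" unfolding c_def using e(1,2)
      by (simp add: awalk_Cons_iff del: awalk_append_iff)
    moreover have "awalk_verts ?x (r @ [(?y, u)]) = awalk_verts ?x r @ [u]"
      using awalk_verts_append[OF tail] rw by simp
    then have "distinct (tl (awalk_verts u c))"
      unfolding c_def using r r_u by (simp add: apath_def)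
    ultimately have "cycle c" unfolding cycle_def c_def by blast
    moreover have "3 \<le> length c" using \<open>r \<noteq> []\<close> by (cases r) (auto simp: c_def)
    ultimately show ?thesis using acyclic by blast
  qed
qed

text \<open>If the remainders \<open>p\<close> and \<open>q\<close> met again after the branching
  vertex, their initial parts up to there would be equal by uniqueness, contradicting the different
  first arcs.\<close>

lemma apath_branch:
  assumes acyclic: "\<not> (\<exists>p. cycle p \<and> 3 \<le> length p)"
    and "apath t (c @ p) x" "apath t (c @ q) y" and hd: "p = [] \<or> q = [] \<or> hd p \<noteq> hd q"
  shows "apath x (rev_path p @ q) y"
proof -
  define b where "b = last (pawalk_verts t c)"
  have pq: "apath b p x" "apath b q y"
    using assms(2,3) unfolding b_def by (simp_all add: apath_append_iff)
  then have walks: "awalk b p x" "awalk b q y" by (auto simp: apath_def)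
  have common: "z = b" if z: "z \<in> set (awalk_verts b p)" "z \<in> set (awalk_verts b q)" for z
  proof -
    obtain p1 p2 where p12: "p = p1 @ p2" "awalk b p1 z" using awalk_decomp[OF walks(1) z(1)] by blast
    obtain q1 q2 where q12: "q = q1 @ q2" "awalk b q1 z" using awalk_decomp[OF walks(2) z(2)] by blast
    have "apath b p1 z" using pq(1) p12 by (auto simp: apath_append_iff)
    moreover have "apath b q1 z" using pq(2) q12 by (auto simp: apath_append_iff)
    ultimately have "p1 = q1" using apath_unique[OF acyclic] by blast
    then have "p1 = []" using hd p12(1) q12(1) by (cases p1) auto
    then show ?thesis using p12(2) by (simp add: awalk_Nil_iff)
  qed
  have rev: "apath x (rev_path p) b" using pq(1) by simp
  then have rev_b: "last (pawalk_verts x (rev_path p)) = b" by (auto simp: apath_def)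
  have "b \<notin> set (tl (awalk_verts b q))"
    using pq(2) walks(2) by (cases q) (auto simp: apath_Cons_iff)
  moreover have "set (tl (awalk_verts b q)) \<subseteq> set (awalk_verts b q)" by (cases q) auto
  ultimately have "set (awalk_verts x (rev_path p)) \<inter> set (tl (awalk_verts b q)) = {}"
    using common awalk_verts_rev_path[OF walks(1)] by auto
  with rev pq(2) have "apath x (rev_path p) (last (pawalk_verts x (rev_path p))) \<and>
      apath (last (pawalk_verts x (rev_path p))) q y \<and>
      set (awalk_verts x (rev_path p)) \<inter> set (tl (awalk_verts (last (pawalk_verts x (rev_path p))) q)) = {}"
    unfolding rev_b by blast
  then show ?thesis by (simp only: apath_append_iff)
qed

end

lemma undirected_treeD:
  assumes "undirected_tree T"
  shows "pair_graph T" "connected (with_proj T)"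
    "\<not> (\<exists>p. pre_digraph.cycle (with_proj T) p \<and> 3 \<le> length p)"
  using assms by (auto simp: undirected_tree_def)

lemma tree_apath_exists:
  assumes "undirected_tree T" "u \<in> pverts T" "v \<in> pverts T"
  shows "\<exists>p. pre_digraph.apath (with_proj T) u p v"
proof -
  interpret pair_graph T using undirected_treeD[OF assms(1)] by blast
  have "strongly_connected (with_proj T)"
    using undirected_treeD(2)[OF assms(1)] sym_arcs symmetric_connected_imp_strongly_connected by blast
  then have "u \<rightarrow>\<^sup>*\<^bsub>with_proj T\<^esub> v" using assms(2,3) by (auto simp: strongly_connected_def)
  then show ?thesis using reachable_apath by blast
qed

lemma tree_dist_eq:
  assumes "undirected_tree T" "pre_digraph.apath (with_proj T) u p v"
  shows "tree_dist T w u v = path_weight w p"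
proof -
  interpret pair_graph T using undirected_treeD[OF assms(1)] by blast
  have "(THE p. apath u p v) = p"
    using apath_unique[OF undirected_treeD(3)[OF assms(1)]] assms(2) by blast
  then show ?thesis by (simp add: tree_dist_def path_weight_def)
qed


lemma tree_dist_sym:
  assumes "undirected_tree T" "u \<in> pverts T" "v \<in> pverts T"
  shows "tree_dist T w u v = tree_dist T w v u"
proof -
  interpret pair_graph T using undirected_treeD[OF assms(1)] by blast
  obtain p where p: "apath u p v" using tree_apath_exists[OF assms] by blast
  then have rev: "apath v (rev_path p) u" by simp
  show ?thesis unfolding tree_dist_eq[OF assms(1) p] tree_dist_eq[OF assms(1) rev] by simp
qed

text \<open>The Gromov product with respect to a base point is the weight of the longest common prefix of
  the paths from it; of three common prefixes the two shorter ones agree.\<close>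
lemma tree_dist_base:
  assumes T: "positive_weighted_tree T w" and t: "t \<in> pverts T"
  obtains g :: "'a \<Rightarrow> 'a \<Rightarrow> real" where
    "\<And>x y. x \<in> pverts T \<Longrightarrow> y \<in> pverts T \<Longrightarrow>
      tree_dist T w x y = tree_dist T w t x + tree_dist T w t y - 2 * g x y"
    "\<And>x y. x \<in> pverts T \<Longrightarrow> y \<in> pverts T \<Longrightarrow> 0 \<le> g x y"
    "\<And>x y z. x \<in> pverts T \<Longrightarrow> y \<in> pverts T \<Longrightarrow> z \<in> pverts T \<Longrightarrow> min (g x z) (g z y) \<le> g x y"
proof -
  have tree: "undirected_tree T" and pos: "\<And>u v. (u, v) \<in> parcs T \<Longrightarrow> 0 < w {u, v}"
    using T by (auto simp: positive_weighted_tree_def)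
  interpret pair_graph T using undirected_treeD[OF tree] by blast
  note acyclic = undirected_treeD(3)[OF tree]
  define path where "path x = (SOME p. apath t p x)" for x
  have path: "apath t (path x) x" if "x \<in> pverts T" for x
    unfolding path_def using someI_ex[OF tree_apath_exists[OF tree t that]] .
  define lcp where "lcp x y = longest_common_prefix (path x) (path y)" for x y
  define g where "g x y = path_weight w (lcp x y)" for x y
  have nonneg: "0 \<le> path_weight w p" if "set p \<subseteq> parcs T" for p
    using that
  proof (induction p)
    case (Cons e p)
    then have "0 < w {fst e, snd e}" using pos by simp
    with Cons show ?case by simp
  qed simp
  have arcs: "set p \<subseteq> parcs T" if "prefix p (path x)" "x \<in> pverts T" for p x
    using path[OF that(2)] that(1) by (auto simp: apath_def prefix_def awalk_def)
  have mono: "path_weight w p \<le> path_weight w q" if pq: "prefix p q" "set q \<subseteq> parcs T" for p q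
  proof -
    obtain r where "q = p @ r" using pq(1) by (auto simp: prefix_def)
    then show ?thesis using nonneg[of r] pq(2) by simp
  qed
  have lcp: "prefix (lcp x y) (path x)" "prefix (lcp x y) (path y)"
    "prefix r (path x) \<Longrightarrow> prefix r (path y) \<Longrightarrow> prefix r (lcp x y)" for x y r
    by (auto simp: lcp_def longest_common_prefix_prefix1 longest_common_prefix_prefix2
        longest_common_prefix_max_prefix)
  have dist: "tree_dist T w x y = tree_dist T w t x + tree_dist T w t y - 2 * g x y"
    if xy: "x \<in> pverts T" "y \<in> pverts T" for x y
  proof -
    obtain p q where p: "path x = lcp x y @ p" and q: "path y = lcp x y @ q"
      using lcp(1,2)[of x y] by (auto simp: prefix_def)
    have "p = [] \<or> q = [] \<or> hd p \<noteq> hd q"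
    proof (rule ccontr)
      assume "\<not> ?thesis"
      then obtain e p' q' where "p = e # p'" "q = e # q'" by (cases p; cases q) auto
      then have "prefix (lcp x y @ [e]) (lcp x y)" using lcp(3)[of "lcp x y @ [e]" x y] p q by simp
      then show False using prefix_length_le by fastforce
    qed
    then have "apath x (rev_path p @ q) y"
      using apath_branch[OF acyclic path[OF xy(1), unfolded p] path[OF xy(2), unfolded q]] by blast
    then have "tree_dist T w x y = path_weight w p + path_weight w q" by (simp add: tree_dist_eq[OF tree])
    moreover have "tree_dist T w t x = path_weight w (path x)" "tree_dist T w t y = path_weight w (path y)"
      using tree_dist_eq[OF tree path] xy by auto
    ultimately show ?thesis using p q by (simp add: g_def)
  qed
  have g_nonneg: "0 \<le> g x y" if "x \<in> pverts T" "y \<in> pverts T" for x y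
    unfolding g_def by (rule nonneg[OF arcs[OF lcp(1) that(1)]])
  have g_min: "min (g x z) (g z y) \<le> g x y" if "x \<in> pverts T" "y \<in> pverts T" "z \<in> pverts T" for x y z
  proof -
    \<comment> \<open>Both are prefixes of the path to \<open>z\<close>, hence comparable; the
      shorter one is common to the paths to \<open>x\<close> and \<open>y\<close>.\<close>
    have "prefix (lcp x z) (lcp z y) \<or> prefix (lcp z y) (lcp x z)"
      using lcp(2)[of x z] lcp(1)[of z y] prefix_same_cases by blast
    then have "prefix (lcp x z) (lcp x y) \<or> prefix (lcp z y) (lcp x y)"
      using lcp(3)[OF lcp(1) prefix_order.trans[OF _ lcp(2)]]
        lcp(3)[OF prefix_order.trans[OF _ lcp(1)] lcp(2)] by blast
    then have "g x z \<le> g x y \<or> g z y \<le> g x y"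
      unfolding g_def using mono[OF _ arcs[OF lcp(1) that(1)]] by blast
    then show ?thesis by linarith
  qed
  show thesis by (rule that[of g]) (fact dist g_nonneg g_min)+
qed

lemma tree_dist_triangle:
  assumes "positive_weighted_tree T w" "{x, y, t} \<subseteq> pverts T"
  shows "tree_dist T w x y \<le> tree_dist T w x t + tree_dist T w t y"
proof -
  have tree: "undirected_tree T" using assms(1) by (simp add: positive_weighted_tree_def)
  have t: "t \<in> pverts T" using assms(2) by simp
  show ?thesis
  proof (rule tree_dist_base[OF assms(1) t])
    fix g :: "'a \<Rightarrow> 'a \<Rightarrow> real" assume g: "\<And>x y. x \<in> pverts T \<Longrightarrow> y \<in> pverts T \<Longrightarrow>
      tree_dist T w x y = tree_dist T w t x + tree_dist T w t y - 2 * g x y"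
    "\<And>x y. x \<in> pverts T \<Longrightarrow> y \<in> pverts T \<Longrightarrow> 0 \<le> g x y"
    "\<And>x y z. x \<in> pverts T \<Longrightarrow> y \<in> pverts T \<Longrightarrow> z \<in> pverts T \<Longrightarrow> min (g x z) (g z y) \<le> g x y"
  have "tree_dist T w x y = tree_dist T w t x + tree_dist T w t y - 2 * g x y" "0 \<le> g x y"
    using assms(2) by (auto intro!: g(1,2))
  then show ?thesis using tree_dist_sym[OF tree, of x t w] assms(2) by simp
  qed
qed

text \<open>With \<open>t\<close> as base point the three sums share the distances from
  \<open>t\<close> to \<open>x\<close>, \<open>y\<close>, \<open>z\<close> and differ only in the
  Gromov product subtracted, so the claim is the ultrametric-type inequality for
  \<open>g\<close>.\<close>

lemma tree_dist_four_point:
  assumes "positive_weighted_tree T w" "{x, y, z, t} \<subseteq> pverts T"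
  shows "tree_dist T w x y + tree_dist T w z t \<le>
    max (tree_dist T w x z + tree_dist T w y t) (tree_dist T w x t + tree_dist T w y z)"
proof -
  have tree: "undirected_tree T" using assms(1) by (simp add: positive_weighted_tree_def)
  have t: "t \<in> pverts T" using assms(2) by simp
  show ?thesis
  proof (rule tree_dist_base[OF assms(1) t])
    fix g :: "'a \<Rightarrow> 'a \<Rightarrow> real" assume g: "\<And>x y. x \<in> pverts T \<Longrightarrow> y \<in> pverts T \<Longrightarrow>
      tree_dist T w x y = tree_dist T w t x + tree_dist T w t y - 2 * g x y"
    "\<And>x y. x \<in> pverts T \<Longrightarrow> y \<in> pverts T \<Longrightarrow> 0 \<le> g x y"
    "\<And>x y z. x \<in> pverts T \<Longrightarrow> y \<in> pverts T \<Longrightarrow> z \<in> pverts T \<Longrightarrow> min (g x z) (g z y) \<le> g x y"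
  have yz: "y \<in> pverts T" "z \<in> pverts T" using assms(2) by auto
  have "g y z = g z y"
    using g(1)[OF yz] g(1)[OF yz(2,1)] tree_dist_sym[OF tree yz, of w] by linarith
  moreover have "tree_dist T w x t = tree_dist T w t x" "tree_dist T w y t = tree_dist T w t y"
    "tree_dist T w z t = tree_dist T w t z"
    using tree_dist_sym[OF tree] assms(2) by auto
  moreover have "g x z \<le> g x y \<or> g z y \<le> g x y" using g(3)[of x y z] assms(2) by (simp add: min_le_iff_disj)
  moreover have "tree_dist T w x y = tree_dist T w t x + tree_dist T w t y - 2 * g x y"
    "tree_dist T w x z = tree_dist T w t x + tree_dist T w t z - 2 * g x z"
    "tree_dist T w y z = tree_dist T w t y + tree_dist T w t z - 2 * g y z"
    using assms(2) by (auto intro!: g(1))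
  ultimately show ?thesis by linarith
  qed
qed

section \<open>The tree of a laminar family\<close>

text \<open>A rooted tree given by its parent function. The set \<open>below c\<close> is the side, away from the root,
  of the edge from \<open>c\<close> to its parent.\<close>
locale parent_tree =
  fixes V :: "'a set" and r :: 'a and parent :: "'a \<Rightarrow> 'a" and height :: "'a \<Rightarrow> nat"
    and below :: "'a \<Rightarrow> 'a set" and wt :: "'a \<Rightarrow> real" and w :: "'a set \<Rightarrow> real"
  assumes finite_V: "finite V" and root: "r \<in> V"
    and parent_V: "x \<in> V - {r} \<Longrightarrow> parent x \<in> V"
    and height: "x \<in> V - {r} \<Longrightarrow> height x < height (parent x)"
    and below: "x \<in> V - {r} \<Longrightarrow> c \<in> V - {r} \<Longrightarrow> (x \<in> below c) \<noteq> (parent x \<in> below c) \<longleftrightarrow> x = c"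
    and wt_pos: "c \<in> V - {r} \<Longrightarrow> 0 < wt c"
    and w: "c \<in> V - {r} \<Longrightarrow> w {c, parent c} = wt c"
begin

definition T :: "'a pair_pre_digraph" where
  "T = \<lparr> pverts = V, parcs = (\<lambda>x. (x, parent x)) ` (V - {r}) \<union> (\<lambda>x. (parent x, x)) ` (V - {r}) \<rparr>"

lemma pverts_T [simp]: "pverts T = V"
  by (simp add: T_def)

lemma parcs_T: "(x, y) \<in> parcs T \<longleftrightarrow> x \<in> V - {r} \<and> y = parent x \<or> y \<in> V - {r} \<and> x = parent y"
  by (auto simp: T_def)

sublocale pair_graph T
proof
  show "finite (pverts T)" "finite (parcs T)" using finite_V by (auto simp: T_def)
  show "fst e \<in> pverts T" "snd e \<in> pverts T" if "e \<in> parcs T" for e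
    using that parent_V by (cases e; auto simp: parcs_T)+
  show "fst e \<noteq> snd e" if "e \<in> parcs T" for e
    using that height by (cases e) (force simp: parcs_T)
  show "symmetric (with_proj T)"
    unfolding symmetric_def by (rule symI) (auto simp: parcs_T)
qed

lemma below_arc:
  assumes "(x, y) \<in> parcs T" "c \<in> V - {r}"
  shows "(x \<in> below c) \<noteq> (y \<in> below c) \<longleftrightarrow> {x, y} = {c, parent c}"
  using assms(1) unfolding parcs_T
proof (elim disjE conjE)
  assume h: "x \<in> V - {r}" "y = parent x"
  have "{x, parent x} = {c, parent c} \<longleftrightarrow> x = c"
    using height[OF h(1)] height[OF assms(2)] by (auto simp: doubleton_eq_iff)
  then show ?thesis using below[OF h(1) assms(2)] h(2) by blast
next
  assume h: "y \<in> V - {r}" "x = parent y"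
  have "{parent y, y} = {c, parent c} \<longleftrightarrow> y = c"
    using height[OF h(1)] height[OF assms(2)] by (auto simp: doubleton_eq_iff)
  then show ?thesis using below[OF h(1) assms(2)] h(2) by blast
qed

lemma arc_edge:
  assumes "(x, y) \<in> parcs T"
  shows "\<exists>c\<in>V - {r}. {x, y} = {c, parent c}"
  using assms by (auto simp: parcs_T)

lemma below_awalk:
  assumes "awalk x p y" "c \<in> V - {r}" "\<And>u v. (u, v) \<in> set p \<Longrightarrow> {u, v} \<noteq> {c, parent c}"
  shows "x \<in> below c \<longleftrightarrow> y \<in> below c"
  using assms(1,3)
proof (induction p arbitrary: x)
  case Nil
  then show ?case by (simp add: awalk_Nil_iff)
next
  case (Cons e p)
  obtain z where e: "e = (x, z)" "(x, z) \<in> parcs T" "awalk z p y"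
    using Cons.prems(1) by (cases e) (auto simp: awalk_Cons_iff)
  then show ?case using Cons.IH[OF e(3)] Cons.prems(2) below_arc[OF e(2) assms(2)] by auto
qed

lemma reachable_root:
  assumes "x \<in> V"
  shows "x \<rightarrow>\<^sup>*\<^bsub>with_proj T\<^esub> r"
  using assms
proof (induction "Max (height ` V) - height x" arbitrary: x rule: less_induct)
  case less
  show ?case
  proof (cases "x = r")
    case False
    then have x: "x \<in> V - {r}" using less.prems by simp
    have "height (parent x) \<le> Max (height ` V)" using finite_V parent_V[OF x] by simp
    then have "parent x \<rightarrow>\<^sup>*\<^bsub>with_proj T\<^esub> r" using less.hyps[OF _ parent_V[OF x]] height[OF x] by simp
    moreover have "(x, parent x) \<in> parcs T" using x by (simp add: parcs_T)
    ultimately show ?thesis using adj_reachable_trans by simp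
  qed (use root in auto)
qed

text \<open>The first arc of a cycle changes sides of its edge, so the rest must use that edge
  again. In the same direction this repeats a vertex; in the opposite one the rest is that single
  arc, and the closed walk has length 2.\<close>

lemma no_cycle: "\<not> (\<exists>p. cycle p \<and> 3 \<le> length p)"
proof
  assume "\<exists>p. cycle p \<and> 3 \<le> length p"
  then obtain p u where p: "awalk u p u" "distinct (tl (awalk_verts u p))" "3 \<le> length p"
    by (auto simp: cycle_def)
  then obtain e p' where ep: "p = e # p'" by (cases p) auto
  obtain k where e: "e = (u, k)" "(u, k) \<in> parcs T" and walk: "awalk k p' u"
    using p(1) unfolding ep by (cases e) (auto simp: awalk_Cons_iff)
  have path: "apath k p' u" using walk p(2) by (simp add: apath_def ep e(1))
  obtain c where c: "c \<in> V - {r}" "{u, k} = {c, parent c}" using arc_edge[OF e(2)] by blast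
  have "(k \<in> below c) \<noteq> (u \<in> below c)" using below_arc[OF e(2) c(1)] c(2) by blast
  then have "\<not> (\<forall>a b. (a, b) \<in> set p' \<longrightarrow> {a, b} \<noteq> {c, parent c})"
    using below_awalk[OF walk c(1)] by metis
  then obtain a b where ab: "(a, b) \<in> set p'" "{a, b} = {u, k}" unfolding c(2) by blast
  obtain p1 p2 where p12: "p' = p1 @ (a, b) # p2" using ab(1) by (meson split_list)
  have sub: "apath k (p1 @ (a, b) # p2) u" using path p12 by simp
  have "u \<noteq> k" using e(2) no_loops' by blast
  from ab(2) \<open>u \<noteq> k\<close> consider "a = u" "b = k" | "a = k" "b = u" by (auto simp: doubleton_eq_iff)
  then show False
  proof cases
    case 1
    then have "apath k p1 u" "apath k p2 u" "set (awalk_verts k p1) \<inter> set (awalk_verts k p2) = {}"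
      using sub by (auto simp: apath_append_iff apath_Cons_iff)
    then show False using hd_in_awalk_verts(2) by blast
  next
    case 2
    then have "apath k p1 k" "apath u p2 u"
      using sub by (auto simp: apath_append_iff apath_Cons_iff)
    then have "p1 = []" "p2 = []" using apath_nonempty_ends by blast+
    then show False using p(3) by (simp add: ep p12)
  qed
qed

lemma undirected_tree_T: "undirected_tree T"
proof -
  have "connected (with_proj T)"
  proof (rule connectedI)
    fix u v assume "u \<in> pverts T" "v \<in> pverts T"
    then have "u \<rightarrow>\<^sup>*\<^bsub>with_proj T\<^esub> r" "r \<rightarrow>\<^sup>*\<^bsub>with_proj T\<^esub> v"
      using reachable_root symmetric_reachable' by auto
    then have "u \<rightarrow>\<^sup>*\<^bsub>with_proj T\<^esub> v" by (rule reachable_trans)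
    then show "u \<rightarrow>\<^sup>*\<^bsub>with_proj (mk_symmetric (with_proj T))\<^esub> v" by (rule reachable_mk_symmetricI)
  qed (use root in auto)
  then show ?thesis using no_cycle pair_graph unfolding undirected_tree_def by blast
qed

lemma positive_weighted_tree_T: "positive_weighted_tree T w"
proof -
  have "0 < w {x, y}" if arc: "(x, y) \<in> parcs T" for x y
  proof -
    obtain c where "c \<in> V - {r}" "{x, y} = {c, parent c}" using arc_edge[OF arc] by blast
    then show ?thesis using w[of c] wt_pos[of c] by simp
  qed
  then show ?thesis unfolding positive_weighted_tree_def using undirected_tree_T by blast
qed

text \<open>The first arc flips membership in \<open>below\<close> for its own edge only, and the
  rest of the path avoids this edge because it never returns to the starting point.\<close>

lemma path_weight_eq:
  assumes "apath x p y"
  shows "path_weight w p = (\<Sum>c\<in>V - {r}. of_bool ((x \<in> below c) \<noteq> (y \<in> below c)) * wt c)"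
  using assms
proof (induction p arbitrary: x)
  case Nil
  then show ?case by (simp add: apath_Nil_iff)
next
  case (Cons e p)
  obtain z where e: "e = (x, z)" "(x, z) \<in> parcs T" and path: "apath z p y" "x \<notin> set (awalk_verts z p)"
    using Cons.prems by (cases e) (auto simp: apath_Cons_iff)
  obtain c where c: "c \<in> V - {r}" "{x, z} = {c, parent c}" using arc_edge[OF e(2)] by blast
  have walk: "awalk z p y" using path(1) by (simp add: apath_def)
  have "z \<in> below c \<longleftrightarrow> y \<in> below c"
  proof (rule below_awalk[OF walk c(1)])
    fix u v assume uv: "(u, v) \<in> set p"
    then have "u \<noteq> x" "v \<noteq> x" using path(2) set_awalk_verts[OF walk] by force+
    then show "{u, v} \<noteq> {c, parent c}" using c(2) by auto
  qed
  moreover have "(x \<in> below d) \<noteq> (z \<in> below d) \<longleftrightarrow> d = c" if "d \<in> V - {r}" for d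
  proof -
    have "{c, parent c} = {d, parent d} \<longleftrightarrow> d = c"
      using height[OF c(1)] height[OF that] by (auto simp: doubleton_eq_iff)
    then show ?thesis using below_arc[OF e(2) that] c(2) by simp
  qed
  ultimately have "of_bool ((x \<in> below d) \<noteq> (y \<in> below d)) * wt d =
      (if d = c then wt c else 0) + of_bool ((z \<in> below d) \<noteq> (y \<in> below d)) * wt d"
    if "d \<in> V - {r}" for d
    using that by (cases "d = c") auto
  then have "(\<Sum>d\<in>V - {r}. of_bool ((x \<in> below d) \<noteq> (y \<in> below d)) * wt d) =
      wt c + (\<Sum>d\<in>V - {r}. of_bool ((z \<in> below d) \<noteq> (y \<in> below d)) * wt d)"
    using c(1) finite_V by (simp add: sum.distrib)
  then show ?case using Cons.IH[OF path(1)] w[OF c(1)] c(2) by (simp add: e(1))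
qed

lemma tree_dist_T:
  assumes "x \<in> V" "y \<in> V"
  shows "tree_dist T w x y = (\<Sum>c\<in>V - {r}. of_bool ((x \<in> below c) \<noteq> (y \<in> below c)) * wt c)"
proof -
  obtain p where p: "apath x p y" using tree_apath_exists[OF undirected_tree_T, of x y] assms by auto
  then show ?thesis using tree_dist_eq[OF undirected_tree_T p] path_weight_eq by simp
qed

end

text \<open>Every member of \<open>L\<close> is at once an inner vertex or a leaf and the edge to
  its parent. The set \<open>{2..n}\<close> is the pendant edge of leaf 1, and the singletons are
  those of the other leaves.\<close>

locale laminar_family =
  fixes n :: nat and L :: "nat set set" and \<omega> :: "nat set \<Rightarrow> real"
  assumes n: "2 \<le> n" and sub: "X \<in> L \<Longrightarrow> X \<subseteq> {2..n}" and nonempty: "X \<in> L \<Longrightarrow> X \<noteq> {}"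
    and full: "{2..n} \<in> L" and singleton: "x \<in> {2..n} \<Longrightarrow> {x} \<in> L"
    and laminar: "X \<in> L \<Longrightarrow> Y \<in> L \<Longrightarrow> X \<subseteq> Y \<or> Y \<subseteq> X \<or> X \<inter> Y = {}"
    and pos: "X \<in> L \<Longrightarrow> 0 < \<omega> X"
begin

definition R :: "nat set" where "R = {1..n}"

text \<open>The root, leaf 1, is represented by the set of all leaves.\<close>
definition K :: "nat set set" where "K = insert R L"

definition up :: "nat set \<Rightarrow> nat set" where "up X = \<Inter>{Y \<in> K. X \<subset> Y}"

text \<open>Vertices must be natural numbers with the leaves being exactly \<open>1..n\<close>: the
  root becomes 1, a singleton its element, and inner vertices are coded beyond
  \<open>n\<close>.\<close>

definition enc :: "nat set \<Rightarrow> nat" where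
  "enc X = (if X = R then 1 else if card X = 1 then the_elem X else n + 1 + set_encode X)"

definition dec :: "nat \<Rightarrow> nat set" where "dec = inv_into K enc"

lemma finite_L: "finite L"
  using sub by (intro finite_subset[of L "Pow {2..n}"]) auto

lemma L_psubset:
  assumes "X \<in> L"
  shows "X \<subset> R"
proof -
  have "X \<subseteq> {2..n}" "1 \<in> R" "{2..n} \<subseteq> R" "1 \<notin> {2..n}" using sub[OF assms] n by (auto simp: R_def)
  then show ?thesis by blast
qed

lemma finite_K: "finite K"
  using finite_L by (simp add: K_def)

lemma K_sub: "X \<in> K \<Longrightarrow> X \<subseteq> R"
  using L_psubset by (auto simp: K_def)

lemma K_finite: "X \<in> K \<Longrightarrow> finite X"
  using K_sub finite_subset[of X R] by (simp add: R_def)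

text \<open>All members strictly above the nonempty set \<open>X\<close> meet, so laminarity makes
  them a chain; its least element is the intersection.\<close>

lemma up:
  assumes "X \<in> L"
  shows "up X \<in> K" "X \<subset> up X" "Y \<in> K \<Longrightarrow> X \<subset> Y \<Longrightarrow> up X \<subseteq> Y"
proof -
  let ?F = "{Y \<in> K. X \<subset> Y}"
  have "R \<in> ?F" using L_psubset[OF assms] by (simp add: K_def)
  then have "?F \<noteq> {}" by blast
  moreover have "finite ?F" using finite_K by simp
  ultimately obtain m where m: "m \<in> ?F" "\<forall>Y\<in>?F. Y \<subseteq> m \<longrightarrow> m = Y"
    using finite_has_minimal[of ?F] by blast
  have "m \<subseteq> Y" if Y: "Y \<in> ?F" for Y
  proof -
    have "m \<in> K" "Y \<in> K" using m(1) Y by auto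
    then have "m \<subseteq> Y \<or> Y \<subseteq> m \<or> m \<inter> Y = {}"
      using laminar[of m Y] K_sub[of m] K_sub[of Y] by (auto simp: K_def)
    moreover have "m \<inter> Y \<noteq> {}" using m(1) Y nonempty[OF assms] by blast
    ultimately show ?thesis using m(2) Y by blast
  qed
  then have "up X = m" unfolding up_def using m(1) by blast
  then show "up X \<in> K" "X \<subset> up X" using m(1) by auto
  show "up X \<subseteq> Y" if "Y \<in> K" "X \<subset> Y" using that by (auto simp: up_def)
qed

lemma enc_root: "enc R = 1"
  by (simp add: enc_def)

lemma enc_singleton:
  assumes "x \<in> {2..n}"
  shows "enc {x} = x"
proof -
  have "{x} \<noteq> R" using L_psubset[OF singleton[OF assms]] by blast
  then show ?thesis by (simp add: enc_def)
qed

lemma enc_large: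
  assumes "X \<in> L" "card X \<noteq> 1"
  shows "enc X = n + 1 + set_encode X"
  using assms L_psubset by (auto simp: enc_def)

lemma L_cases:
  assumes "X \<in> L"
  obtains x where "x \<in> {2..n}" "X = {x}" | "card X \<noteq> 1"
proof (cases "card X = 1")
  case True
  then obtain x where "X = {x}" by (auto simp: card_1_singleton_iff)
  then show thesis using that(1)[of x] sub[OF assms] by blast
qed (use that in blast)

lemma enc_L_ne_root:
  assumes "X \<in> L"
  shows "enc X \<noteq> enc R"
proof (cases rule: L_cases[OF assms])
  case (1 x)
  then show ?thesis using enc_singleton[of x] by (simp add: enc_root)
next
  case 2
  then show ?thesis using enc_large[OF assms] n by (simp add: enc_root)
qed

lemma inj_enc: "inj_on enc K"
proof -
  have "X = Y" if XY: "X \<in> L" "Y \<in> L" "enc X = enc Y" for X Y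
  proof (cases rule: L_cases[OF XY(1)])
    case (1 x)
    then show ?thesis
      using XY(3) by (cases rule: L_cases[OF XY(2)]) (auto simp: enc_singleton enc_large[OF XY(2)])
  next
    case 2
    then show ?thesis
    proof (cases rule: L_cases[OF XY(2)])
      case (1 y)
      then show ?thesis using XY(3) 2 by (auto simp: enc_singleton enc_large[OF XY(1)])
    next
      case 2
      then have "set_encode X = set_encode Y" using XY(3) \<open>card X \<noteq> 1\<close> XY(1,2) by (simp add: enc_large)
      moreover have "finite X" "finite Y" using XY K_finite by (auto simp: K_def)
      ultimately show ?thesis by (metis set_encode_inverse)
    qed
  qed
  moreover have "enc X \<noteq> enc R" if "X \<in> L" for X by (rule enc_L_ne_root[OF that])
  ultimately show ?thesis unfolding inj_on_def K_def by (metis insert_iff)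
qed

lemma dec_enc: "X \<in> K \<Longrightarrow> dec (enc X) = X"
  unfolding dec_def using inj_enc by simp

lemma L_in_K: "X \<in> L \<Longrightarrow> X \<in> K"
  by (simp add: K_def)

lemma non_root: "enc ` K - {enc R} = enc ` L"
proof -
  have "enc R \<notin> enc ` L" using enc_L_ne_root by (metis imageE)
  then show ?thesis unfolding K_def by simp
qed

text \<open>The ends of an edge decode to nested sets. Their intersection is the lower one, which
  names the edge, so the weight depends only on the unordered pair.\<close>

sublocale parent_tree "enc ` K" "enc R" "\<lambda>v. enc (up (dec v))" "\<lambda>v. card (dec v)"
  "\<lambda>c. {v \<in> enc ` K. dec v \<subseteq> dec c}" "\<lambda>v. \<omega> (dec v)" "\<lambda>e. \<omega> (\<Inter>(dec ` e))"
proof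
  show "finite (enc ` K)" using finite_K by simp
  show "enc R \<in> enc ` K" by (simp add: K_def)
  fix x assume "x \<in> enc ` K - {enc R}"
  then obtain X where X: "X \<in> L" "x = enc X" unfolding non_root by blast
  have dX: "dec x = X" "dec (enc (up X)) = up X"
    using X up(1) by (simp_all add: dec_enc L_in_K)
  show "enc (up (dec x)) \<in> enc ` K" using up(1)[OF X(1)] by (simp add: dX)
  have "card X < card (up X)" 
    by (rule psubset_card_mono[OF K_finite[OF up(1)[OF X(1)]] up(2)[OF X(1)]])
  then show "card (dec x) < card (dec (enc (up (dec x))))" by (simp only: dX)
  show "0 < \<omega> (dec x)" using pos X dX by simp
  show "\<omega> (\<Inter>(dec ` {x, enc (up (dec x))})) = \<omega> (dec x)"
  proof -
    have "dec x \<inter> dec (enc (up (dec x))) = X" unfolding dX using up(2)[OF X(1)] by blast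
    then show ?thesis by (simp add: dX)
  qed
  fix c assume "c \<in> enc ` K - {enc R}"
  then obtain C where C: "C \<in> L" "c = enc C" unfolding non_root by blast
  have dC: "dec c = C" using C by (simp add: dec_enc L_in_K)
  have "(X \<subseteq> C) \<noteq> (up X \<subseteq> C) \<longleftrightarrow> X = C"
    using up(2)[OF X(1)] up(3)[OF X(1) L_in_K[OF C(1)]] by blast
  moreover have "x = c \<longleftrightarrow> X = C" using X(2) C(2) dX(1) dC by metis
  moreover have "x \<in> enc ` K" "enc (up (dec x)) \<in> enc ` K" using X L_in_K up(1)[OF X(1)] dX by auto
  ultimately show "(x \<in> {v \<in> enc ` K. dec v \<subseteq> dec c}) \<noteq>
      (enc (up (dec x)) \<in> {v \<in> enc ` K. dec v \<subseteq> dec c}) \<longleftrightarrow> x = c"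
    by (simp add: dX dC)
qed

lemma leaf_in_V:
  assumes "i \<in> {1..n}"
  shows "i \<in> enc ` K" "X \<in> L \<Longrightarrow> dec i \<subseteq> X \<longleftrightarrow> i \<in> X"
proof -
  have *: "i \<in> enc ` K \<and> (X \<in> L \<longrightarrow> (dec i \<subseteq> X \<longleftrightarrow> i \<in> X))"
  proof (cases "i = 1")
    case True
    have "R \<in> K" by (simp add: K_def)
    then have "1 \<in> enc ` K" "dec 1 = R" using enc_root dec_enc by (metis image_eqI)+
    moreover have "\<not> R \<subseteq> X" "1 \<notin> X" if "X \<in> L" using L_psubset[OF that] sub[OF that] by auto
    ultimately show ?thesis using True by simp
  next
    case False
    then have i: "i \<in> {2..n}" using assms by auto
    then have "{i} \<in> K" using singleton by (simp add: K_def)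
    then have "i \<in> enc ` K" "dec i = {i}" using enc_singleton[OF i] dec_enc by (metis image_eqI)+
    then show ?thesis by simp
  qed
  then show "i \<in> enc ` K" "X \<in> L \<Longrightarrow> dec i \<subseteq> X \<longleftrightarrow> i \<in> X" by auto
qed

lemma tree_dist_leaves:
  assumes "i \<in> {1..n}" "j \<in> {1..n}"
  shows "tree_dist T (\<lambda>e. \<omega> (\<Inter>(dec ` e))) i j = (\<Sum>X\<in>L. of_bool (crosses {i, j} X) * \<omega> X)"
proof -
  have inj: "inj_on enc L" using inj_enc by (rule inj_on_subset) (auto simp: K_def)
  show ?thesis
    unfolding tree_dist_T[OF leaf_in_V(1)[OF assms(1)] leaf_in_V(1)[OF assms(2)]] non_root
      sum.reindex[OF inj] comp_def
    using leaf_in_V assms by (intro sum.cong refl) (simp add: dec_enc L_in_K)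
qed

text \<open>The root has the single child \<open>{2..n}\<close>, and a singleton has only its
  parent. Any other member has a parent and a child, so its degree is at least 2.\<close>

lemma leaves_T: "leaves T = {1..n}"
proof -
  have deg: "out_degree (with_proj T) v = card {y. (v, y) \<in> parcs T}" for v
  proof -
    have "out_arcs (with_proj T) v = Pair v ` {y. (v, y) \<in> parcs T}" by (auto simp: out_arcs_def)
    then show ?thesis by (simp add: out_degree_def card_image inj_on_def)
  qed
  have nbrs: "{y. (enc X, y) \<in> parcs T} = (if X \<in> L then {enc (up X)} else {}) \<union> enc ` {Y \<in> L. up Y = X}"
    if X: "X \<in> K" for X
  proof -
    have "enc X \<in> enc ` L \<longleftrightarrow> X \<in> L"
      using inj_on_image_mem_iff[OF inj_enc X, of L] by (auto simp: K_def)
    moreover have "y \<in> enc ` L \<and> enc X = enc (up (dec y)) \<longleftrightarrow> y \<in> enc ` {Y \<in> L. up Y = X}" for y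
    proof -
      have "enc X = enc (up (dec (enc Y))) \<longleftrightarrow> up Y = X" if "Y \<in> L" for Y
        using inj_on_eq_iff[OF inj_enc X up(1)[OF that]] dec_enc[OF L_in_K[OF that]] by auto
      then show ?thesis by blast
    qed
    ultimately show ?thesis by (auto simp: parcs_T non_root dec_enc[OF X])
  qed
  have "{Y \<in> L. up Y = R} = {{2..n}}"
  proof (intro equalityI subsetI)
    fix Y assume "Y \<in> {Y \<in> L. up Y = R}"
    then have Y: "Y \<in> L" "up Y = R" by auto
    have "\<not> R \<subseteq> {2..n}" using n by (auto simp: R_def)
    then have "\<not> Y \<subset> {2..n}" using up(3)[OF Y(1) L_in_K[OF full]] Y(2) by auto
    then show "Y \<in> {{2..n}}" using sub[OF Y(1)] by auto
  next
    fix Y assume "Y \<in> {{2..n}}"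
    moreover have "up {2..n} \<notin> L" using up(2)[OF full] sub by blast
    then have "up {2..n} = R" using up(1)[OF full] by (simp add: K_def)
    ultimately show "Y \<in> {Y \<in> L. up Y = R}" using full by simp
  qed
  moreover have "R \<in> K" "R \<notin> L" using L_psubset by (auto simp: K_def)
  ultimately have nbrs_root: "{y. (enc R, y) \<in> parcs T} = {enc {2..n}}" using nbrs[of R] by simp
  have "v \<in> leaves T \<longleftrightarrow> v \<in> {1..n}" if v: "v \<in> enc ` K" for v
  proof -
    obtain X where X: "X \<in> K" "v = enc X" using v by blast
    have leaf: "v \<in> leaves T \<longleftrightarrow> card {y. (v, y) \<in> parcs T} = 1"
      using v unfolding leaves_def deg by simp
    show ?thesis
    proof (cases "X = R")
      case True
      have "card {y. (v, y) \<in> parcs T} = 1" unfolding X(2) True nbrs_root by simp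
      then have "v \<in> leaves T" using leaf by blast
      moreover have "v \<in> {1..n}" using n unfolding X(2) True enc_root by simp
      ultimately show ?thesis by simp
    next
      case False
      then have XL: "X \<in> L" using X(1) by (simp add: K_def)
      show ?thesis
      proof (cases rule: L_cases[OF XL])
        case (1 x)
        have "up Y \<noteq> X" if "Y \<in> L" for Y using up(2)[OF that] nonempty[OF that] 1(2)
          by (auto simp: psubset_eq subset_singleton_iff)
        then have no_child: "{Y \<in> L. up Y = X} = {}" by blast
        have "card {y. (v, y) \<in> parcs T} = 1" unfolding X(2) nbrs[OF X(1)] no_child using XL by simp
        then have "v \<in> leaves T" using leaf by blast
        moreover have "v = x" using 1 X(2) enc_singleton by simp
        ultimately show ?thesis using 1(1) by simp
      next
        case 2
        have finX: "finite X" using K_finite X(1) by blast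
        obtain x where x: "x \<in> X" using nonempty[OF XL] by blast
        then have x2: "x \<in> {2..n}" using sub[OF XL] by blast
        have "{x} \<noteq> X" using 2 by auto
        then have "{Y \<in> L. Y \<subset> X} \<noteq> {}" using x singleton[OF x2] by blast
        moreover have "finite {Y \<in> L. Y \<subset> X}" using finite_L by simp
        ultimately obtain Y where Y: "Y \<in> {Y \<in> L. Y \<subset> X}" "\<forall>Z\<in>{Y \<in> L. Y \<subset> X}. Y \<subseteq> Z \<longrightarrow> Y = Z"
          using finite_has_maximal[of "{Y \<in> L. Y \<subset> X}"] by blast
        have YL: "Y \<in> L" "Y \<subset> X" using Y(1) by auto
        \<comment> \<open>A maximal member properly inside \<open>X\<close> has \<open>X\<close> as
          parent.\<close>
        have "up Y \<subseteq> X" by (rule up(3)[OF YL(1) X(1) YL(2)])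
        moreover have "\<not> up Y \<subset> X"
        proof
          assume h: "up Y \<subset> X"
          then have "up Y \<noteq> R" using K_sub[OF X(1)] by blast
          then have "up Y \<in> L" using up(1)[OF YL(1)] by (simp add: K_def)
          then show False using Y(2) h up(2)[OF YL(1)] by blast
        qed
        ultimately have "up Y = X" by blast
        then have "{enc (up X), enc Y} \<subseteq> {y. (v, y) \<in> parcs T}"
          unfolding X(2) nbrs[OF X(1)] using XL YL(1) by simp
        moreover have "enc (up X) \<noteq> enc Y"
        proof
          assume "enc (up X) = enc Y"
          then have "up X = Y" by (rule inj_onD[OF inj_enc _ up(1)[OF XL] L_in_K[OF YL(1)]])
          then show False using up(2)[OF XL] YL(2) by blast
        qed
        moreover have "finite {y. (v, y) \<in> parcs T}" unfolding X(2) nbrs[OF X(1)] using finite_L by simp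
        ultimately have "2 \<le> card {y. (v, y) \<in> parcs T}"
          using card_mono[of "{y. (v, y) \<in> parcs T}" "{enc (up X), enc Y}"] by simp
        moreover have "v \<notin> {1..n}" using X(2) enc_large[OF XL 2] by simp
        ultimately show ?thesis unfolding leaf by simp
      qed
    qed
  qed
  then show ?thesis using leaf_in_V(1) unfolding leaves_def by auto
qed

end

context quartet_system
begin

text \<open>No cluster contains 1, so two of them never cover \<open>N\<close>; of the four
  alternatives for compatible sides the three laminar ones remain.\<close>

lemma clusters_laminar:
  assumes "2 \<le> n" and "\<And>X. X \<in> clusters \<Longrightarrow> 0 < \<omega> X"
  shows "laminar_family n clusters \<omega>"
proof
  have N1: "N - {1} = {2..n}" "1 \<in> N" "2 \<in> N" using assms(1) by (auto simp: N_def)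
  have single: "{x} \<in> sides" if "x \<in> N" for x
  proof (rule sides_singleton[OF that])
    show "{x} \<noteq> N"
    proof
      assume "{x} = N"
      then have "1 = x" "2 = x" using N1(2,3) by blast+
      then show False by simp
    qed
  qed
  show "X \<subseteq> {2..n}" if "X \<in> clusters" for X
    using that sidesD(1)[of X] N1(1) by (auto simp: clusters_def)
  show "X \<noteq> {}" if "X \<in> clusters" for X
    using that sidesD(2) by (simp add: clusters_def)
  show "{2..n} \<in> clusters"
    using sides_compl[OF single[OF N1(2)]] unfolding N1(1) by (simp add: clusters_def)
  show "{x} \<in> clusters" if "x \<in> {2..n}" for x
    using that single[of x] by (auto simp: clusters_def N_def)
  show "X \<subseteq> Y \<or> Y \<subseteq> X \<or> X \<inter> Y = {}" if "X \<in> clusters" "Y \<in> clusters" for X Y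
  proof -
    have "X \<union> Y \<noteq> N" using that N1(2) by (auto simp: clusters_def)
    then show ?thesis using sides_compatible[of X Y] that by (auto simp: clusters_def)
  qed
qed (use assms in auto)

end

section \<open>The quartet system of a tree\<close>

locale four_point_pairs =
  fixes n :: nat and \<delta> :: "nat set \<Rightarrow> real"
  assumes triangle: "distinct [a, b, c] \<Longrightarrow> {a, b, c} \<subseteq> {1..n} \<Longrightarrow> \<delta> {a, b} \<le> \<delta> {a, c} + \<delta> {c, b}"
    and four_point: "distinct [a, b, c, d] \<Longrightarrow> {a, b, c, d} \<subseteq> {1..n} \<Longrightarrow>
      \<delta> {a, b} + \<delta> {c, d} \<le> max (\<delta> {a, c} + \<delta> {b, d}) (\<delta> {a, d} + \<delta> {b, c})"
begin

text \<open>Of the three pairings of \<open>p \<union> p'\<close>, this one has the least total.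
  Quantifying over all labelings makes it a property of sets.\<close>

definition opposite :: "nat set \<Rightarrow> nat set \<Rightarrow> bool" where
  "opposite p p' \<longleftrightarrow> (\<forall>x\<in>p. \<forall>x'\<in>p. \<forall>y\<in>p'. \<forall>y'\<in>p'. x \<noteq> x' \<longrightarrow> y \<noteq> y' \<longrightarrow>
     \<delta> p + \<delta> p' \<le> \<delta> {x, y} + \<delta> {x', y'})"

definition S :: "nat set set set" where
  "S = {{p, p'} | p p'. p \<in> [{1..n}]\<^bsup>2\<^esup> \<and> p' \<in> [{1..n}]\<^bsup>2\<^esup> \<and> p \<inter> p' = {} \<and> opposite p p'}"

lemma opposite_sym:
  assumes "opposite p p'"
  shows "opposite p' p"
  unfolding opposite_def
proof (intro ballI impI)
  fix x x' y y' assume h: "x \<in> p'" "x' \<in> p'" "y \<in> p" "y' \<in> p" "x \<noteq> x'" "y \<noteq> y'"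
  have "\<delta> p + \<delta> p' \<le> \<delta> {y, x} + \<delta> {y', x'}"
    using assms[unfolded opposite_def, rule_format, OF h(3,4,1,2,6,5)] .
  moreover have "{y, x} = {x, y}" "{y', x'} = {x', y'}" by auto
  ultimately show "\<delta> p' + \<delta> p \<le> \<delta> {x, y} + \<delta> {x', y'}" by simp
qed

lemma S_iff:
  assumes "distinct [a, b, c, d]" "{a, b, c, d} \<subseteq> {1..n}"
  shows "{{a, b}, {c, d}} \<in> S \<longleftrightarrow>
    \<delta> {a, b} + \<delta> {c, d} \<le> \<delta> {a, c} + \<delta> {b, d} \<and> \<delta> {a, b} + \<delta> {c, d} \<le> \<delta> {a, d} + \<delta> {b, c}"
proof -
  have "{{a, b}, {c, d}} \<in> S \<longleftrightarrow> opposite {a, b} {c, d}"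
  proof
    assume "{{a, b}, {c, d}} \<in> S"
    then obtain p p' where "{{a, b}, {c, d}} = {p, p'}" "opposite p p'" by (auto simp: S_def)
    then show "opposite {a, b} {c, d}" using opposite_sym by (metis doubleton_eq_iff)
  next
    assume "opposite {a, b} {c, d}"
    moreover have "{a, b} \<in> [{1..n}]\<^bsup>2\<^esup>" "{c, d} \<in> [{1..n}]\<^bsup>2\<^esup>" "{a, b} \<inter> {c, d} = {}" using assms by auto
    ultimately show "{{a, b}, {c, d}} \<in> S" unfolding S_def by blast
  qed
  also have "\<dots> \<longleftrightarrow> \<delta> {a, b} + \<delta> {c, d} \<le> \<delta> {a, c} + \<delta> {b, d} \<and> \<delta> {a, b} + \<delta> {c, d} \<le> \<delta> {a, d} + \<delta> {b, c}"
    using assms(1) by (auto simp: opposite_def add.commute)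
  finally show ?thesis .
qed

lemma S_split_system: "split_system n S"
  unfolding split_system_def
proof
  fix s assume "s \<in> S"
  then obtain p p' where s: "s = {p, p'}" "p \<in> [{1..n}]\<^bsup>2\<^esup>" "p' \<in> [{1..n}]\<^bsup>2\<^esup>" "p \<inter> p' = {}"
    unfolding S_def by blast
  then have fin: "finite p" "finite p'" "card p = 2" "card p' = 2" "p \<subseteq> {1..n}" "p' \<subseteq> {1..n}"
    by (auto simp: nsets_def)
  then have "p \<union> p' \<in> [{1..n}]\<^bsup>4\<^esup>" using s(4) by (simp add: nsets_def card_Un_disjoint)
  moreover have "p \<noteq> {}" "p' \<noteq> {}" using fin(3,4) by auto
  then have "partition_on (p \<union> p') {p, p'}" using s(4) by (auto simp: partition_on_def disjoint_def)
  then have "s \<in> splits (p \<union> p')" unfolding splits_def s(1) using fin by (simp add: nsets_def)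
  ultimately show "s \<in> (\<Union>Y\<in>[{1..n}]\<^bsup>4\<^esup>. splits Y)" by blast
qed

text \<open>The four-point inequality for all three pairings: the largest sum is attained twice.
  Hence the minimum is attained once or three times, which is fatness of \<open>S\<close>.\<close>

lemma three_cases:
  assumes "distinct [a, b, c, d]" "{a, b, c, d} \<subseteq> {1..n}"
  shows "let x = \<delta> {a, b} + \<delta> {c, d}; y = \<delta> {a, c} + \<delta> {b, d}; z = \<delta> {a, d} + \<delta> {b, c} in
    x \<le> y \<and> y = z \<or> y \<le> x \<and> x = z \<or> z \<le> x \<and> x = y"
proof -
  have "\<delta> {a, b} + \<delta> {c, d} \<le> max (\<delta> {a, c} + \<delta> {b, d}) (\<delta> {a, d} + \<delta> {b, c})"
    using four_point[of a b c d] assms by blast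
  moreover have "\<delta> {a, c} + \<delta> {b, d} \<le> max (\<delta> {a, b} + \<delta> {c, d}) (\<delta> {a, d} + \<delta> {b, c})"
    using four_point[of a c b d] assms by (auto simp: insert_commute)
  moreover have "\<delta> {a, d} + \<delta> {b, c} \<le> max (\<delta> {a, b} + \<delta> {c, d}) (\<delta> {a, c} + \<delta> {b, d})"
    using four_point[of a d b c] assms by (auto simp: insert_commute)
  ultimately show ?thesis unfolding Let_def by linarith
qed

lemma S_iffs:
  assumes "distinct [a, b, c, d]" "{a, b, c, d} \<subseteq> {1..n}"
  shows "{{a, b}, {c, d}} \<in> S \<longleftrightarrow>
    \<delta> {a, b} + \<delta> {c, d} \<le> \<delta> {a, c} + \<delta> {b, d} \<and> \<delta> {a, b} + \<delta> {c, d} \<le> \<delta> {a, d} + \<delta> {b, c}"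
    "{{a, c}, {b, d}} \<in> S \<longleftrightarrow>
    \<delta> {a, c} + \<delta> {b, d} \<le> \<delta> {a, b} + \<delta> {c, d} \<and> \<delta> {a, c} + \<delta> {b, d} \<le> \<delta> {a, d} + \<delta> {b, c}"
    "{{a, d}, {b, c}} \<in> S \<longleftrightarrow>
    \<delta> {a, d} + \<delta> {b, c} \<le> \<delta> {a, b} + \<delta> {c, d} \<and> \<delta> {a, d} + \<delta> {b, c} \<le> \<delta> {a, c} + \<delta> {b, d}"
proof -
  have d: "distinct [a, c, b, d]" "{a, c, b, d} \<subseteq> {1..n}" "distinct [a, d, b, c]" "{a, d, b, c} \<subseteq> {1..n}"
    using assms by auto
  have "\<delta> {c, b} = \<delta> {b, c}" "\<delta> {d, c} = \<delta> {c, d}" "\<delta> {d, b} = \<delta> {b, d}" by (simp_all add: insert_commute)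
  then show "{{a, b}, {c, d}} \<in> S \<longleftrightarrow>
    \<delta> {a, b} + \<delta> {c, d} \<le> \<delta> {a, c} + \<delta> {b, d} \<and> \<delta> {a, b} + \<delta> {c, d} \<le> \<delta> {a, d} + \<delta> {b, c}"
    "{{a, c}, {b, d}} \<in> S \<longleftrightarrow>
    \<delta> {a, c} + \<delta> {b, d} \<le> \<delta> {a, b} + \<delta> {c, d} \<and> \<delta> {a, c} + \<delta> {b, d} \<le> \<delta> {a, d} + \<delta> {b, c}"
    "{{a, d}, {b, c}} \<in> S \<longleftrightarrow>
    \<delta> {a, d} + \<delta> {b, c} \<le> \<delta> {a, b} + \<delta> {c, d} \<and> \<delta> {a, d} + \<delta> {b, c} \<le> \<delta> {a, c} + \<delta> {b, d}"
    using S_iff[OF assms] S_iff[OF d(1,2)] S_iff[OF d(3,4)] by auto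
qed

lemma S_fat: "fat n S"
  unfolding fat_def
proof
  fix Y assume "Y \<in> [{1..n}]\<^bsup>4\<^esup>"
  then have "finite Y" "card Y = 4" "Y \<subseteq> {1..n}" by (auto simp: nsets_def)
  then obtain xs where xs: "set xs = Y" "distinct xs" "length xs = 4"
    using finite_distinct_list distinct_card by metis
  then obtain a b c d where "xs = [a, b, c, d]" by (auto simp: length_Suc_conv numeral_eq_Suc)
  then have Y: "Y = {a, b, c, d}" "distinct [a, b, c, d]" "{a, b, c, d} \<subseteq> {1..n}"
    using xs \<open>Y \<subseteq> {1..n}\<close> by auto
  define A B C where "A = {{a, b}, {c, d}}" and "B = {{a, c}, {b, d}}" and "C = {{a, d}, {b, c}}"
  have splits: "splits Y = {A, B, C}" unfolding A_def B_def C_def Y(1) by (rule splits_quartet[OF Y(2)])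
  have "A \<in> S \<and> B \<in> S \<and> C \<in> S \<or> A \<in> S \<and> B \<notin> S \<and> C \<notin> S \<or> A \<notin> S \<and> B \<in> S \<and> C \<notin> S \<or>
      A \<notin> S \<and> B \<notin> S \<and> C \<in> S"
    unfolding A_def B_def C_def S_iffs[OF Y(2,3)] using three_cases[OF Y(2,3)] unfolding Let_def by linarith
  then show "card (splits Y \<inter> S) = 1 \<or> splits Y \<subseteq> S"
    unfolding splits by (elim disjE) auto
qed

lemma S_transitive: "transitive n S"
  unfolding transitive_def
proof (intro ballI impI)
  fix a b c d e
  assume N: "a \<in> {1..n}" "b \<in> {1..n}" "c \<in> {1..n}" "d \<in> {1..n}" "e \<in> {1..n}"
    and h: "distinct [a, b, c, d, e] \<and> {{a, b}, {c, d}} \<in> S \<and> {{a, b}, {c, e}} \<in> S"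
  have 1: "distinct [a, b, c, d]" "{a, b, c, d} \<subseteq> {1..n}" "distinct [a, b, c, e]" "{a, b, c, e} \<subseteq> {1..n}"
    "distinct [a, b, d, e]" "{a, b, d, e} \<subseteq> {1..n}" using N h by auto
  show "{{a, b}, {d, e}} \<in> S"
    using h three_cases[OF 1(1,2)] three_cases[OF 1(3,4)] three_cases[OF 1(5,6)]
    unfolding S_iff[OF 1(1,2)] S_iff[OF 1(3,4)] S_iff[OF 1(5,6)] Let_def by linarith
qed

lemma S_saturated: "saturated n S"
  unfolding saturated_def
proof (intro ballI impI)
  fix a b c d x
  assume N: "a \<in> {1..n}" "b \<in> {1..n}" "c \<in> {1..n}" "d \<in> {1..n}" "x \<in> {1..n}"
    and h: "distinct [a, b, c, d, x] \<and> {{a, b}, {c, d}} \<in> S"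
  have 1: "distinct [a, b, c, d]" "{a, b, c, d} \<subseteq> {1..n}" "distinct [a, x, c, d]" "{a, x, c, d} \<subseteq> {1..n}"
    "distinct [a, b, c, x]" "{a, b, c, x} \<subseteq> {1..n}" "distinct [a, b, d, x]" "{a, b, d, x} \<subseteq> {1..n}"
    "distinct [b, x, c, d]" "{b, x, c, d} \<subseteq> {1..n}" using N h by auto
  have sym: "\<delta> {x, c} = \<delta> {c, x}" "\<delta> {x, d} = \<delta> {d, x}" "\<delta> {b, x} = \<delta> {x, b}"
    by (simp_all add: insert_commute)
  \<comment> \<open>With the four-point condition for all five quartets among the five points, this
    is linear arithmetic in the distances.\<close>
  show "{{a, x}, {c, d}} \<in> S \<or> {{a, b}, {c, x}} \<in> S"
    using h three_cases[OF 1(1,2)] three_cases[OF 1(3,4)] three_cases[OF 1(5,6)] three_cases[OF 1(7,8)]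
      three_cases[OF 1(9,10)]
    unfolding S_iff[OF 1(1,2)] S_iff[OF 1(3,4)] S_iff[OF 1(5,6)] Let_def sym by (smt (verit))
qed

text \<open>In the first exchange the named split has the least sum, so the other two sums agree by
  the four-point condition; in the second the replaced pairing is itself the least. A detour is the
  triangle inequality.\<close>

lemma transform_mono:
  assumes "transform n S \<sigma> \<tau>" "set_mset \<sigma> \<subseteq> [{1..n}]\<^bsup>2\<^esup>"
  shows "set_mset \<tau> \<subseteq> [{1..n}]\<^bsup>2\<^esup> \<and> (\<Sum>p\<in>#\<sigma>. \<delta> p) \<le> (\<Sum>p\<in>#\<tau>. \<delta> p)"
  using assms
proof cases
  case (exchange i j k l R)
  have N: "distinct [i, k, j, l]" "{i, k, j, l} \<subseteq> {1..n}" "distinct [j, k, i, l]" "{j, k, i, l} \<subseteq> {1..n}"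
    using exchange assms(2) by auto
  have sym: "\<delta> {j, i} = \<delta> {i, j}" "\<delta> {k, j} = \<delta> {j, k}" "\<delta> {k, i} = \<delta> {i, k}" by (simp_all add: insert_commute)
  have "\<delta> {i, k} + \<delta> {j, l} \<le> \<delta> {i, j} + \<delta> {k, l}"
    using exchange(4) four_point[OF N(1,2)] unfolding S_iff[OF N(3,4)] sym by linarith
  then show ?thesis using exchange assms(2) by auto
next
  case (exchange_only i j k l R)
  have N: "distinct [i, k, j, l]" "{i, k, j, l} \<subseteq> {1..n}"
    using exchange_only assms(2) by auto
  have "{{i, k}, {j, l}} \<in> S" using exchange_only(4) by blast
  then have "\<delta> {i, k} + \<delta> {j, l} \<le> \<delta> {i, j} + \<delta> {k, l}" unfolding S_iff[OF N] by blast
  then show ?thesis using exchange_only assms(2) by auto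
next
  case (detour a b c R)
  have "\<delta> {a, b} \<le> \<delta> {a, c} + \<delta> {c, b}" using triangle detour by auto
  then show ?thesis using detour assms(2) by auto
qed

lemma reach_mono:
  assumes "(transform n S)\<^sup>*\<^sup>* \<sigma> \<tau>" "set_mset \<sigma> \<subseteq> [{1..n}]\<^bsup>2\<^esup>"
  shows "set_mset \<tau> \<subseteq> [{1..n}]\<^bsup>2\<^esup> \<and> (\<Sum>p\<in>#\<sigma>. \<delta> p) \<le> (\<Sum>p\<in>#\<tau>. \<delta> p)"
  using assms(1)
proof induction
  case (step \<rho> \<tau>)
  then show ?case using transform_mono[OF step(2)] by linarith
qed (use assms(2) in simp)

end

text \<open>The empty family only transforms into itself and would demand \<open>0 < 0\<close>. For
  \<open>n = 1\<close> the left side fails, as no finite tree has exactly one vertex of degree 1,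
  while \<open>S = {}\<close> satisfies the right side.\<close>

theorem theorem4p6:
  fixes n :: nat and m M :: "nat set \<Rightarrow> real"
  assumes "2 \<le> n"
    and "\<And>I. I \<in> [{1..n}]\<^bsup>2\<^esup> \<Longrightarrow> 0 < m I"
    and "\<And>I. I \<in> [{1..n}]\<^bsup>2\<^esup> \<Longrightarrow> 0 < M I"
    and "\<And>I. I \<in> [{1..n}]\<^bsup>2\<^esup> \<Longrightarrow> m I < M I"
  shows "(\<exists>(T :: nat pair_pre_digraph) (w :: nat set \<Rightarrow> real).
            positive_weighted_tree T w \<and> leaves T = {1..n} \<and>
            (\<forall>i\<in>{1..n}. \<forall>j\<in>{1..n}. i \<noteq> j \<longrightarrow>
               tree_dist T w i j \<in> {m {i, j}<..<M {i, j}}))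
         \<longleftrightarrow>
         (\<exists>S. split_system n S \<and> fat n S \<and> transitive n S \<and> saturated n S \<and>
            (\<forall>\<sigma> \<tau>. \<sigma> \<noteq> {#} \<and>
               set_mset \<sigma> \<subseteq> [{1..n}]\<^bsup>2\<^esup> \<and> set_mset \<tau> \<subseteq> [{1..n}]\<^bsup>2\<^esup> \<and>
               (transform n S)\<^sup>*\<^sup>* \<sigma> \<tau> \<longrightarrow>
               (\<Sum>I\<in>#\<sigma>. m I) < (\<Sum>I\<in>#\<tau>. M I)))"
    (is "?tree \<longleftrightarrow> ?system")
proof
  assume ?tree
  then obtain T :: "nat pair_pre_digraph" and w :: "nat set \<Rightarrow> real"
    where T: "positive_weighted_tree T w" and leaves: "leaves T = {1..n}"
      and bounds: "\<And>i j. i \<in> {1..n} \<Longrightarrow> j \<in> {1..n} \<Longrightarrow> i \<noteq> j \<Longrightarrow>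
        tree_dist T w i j \<in> {m {i, j}<..<M {i, j}}"
    by blast
  have tree: "undirected_tree T" using T by (simp add: positive_weighted_tree_def)
  have verts: "{1..n} \<subseteq> pverts T" using leaves by (auto simp: leaves_def)
  \<comment> \<open>\<open>Min\<close> and \<open>Max\<close> merely order the two elements, so that
    the distance becomes a function of the 2-set; symmetry makes the order irrelevant.\<close>
  define \<delta> where "\<delta> p = tree_dist T w (Min p) (Max p)" for p
  have \<delta>: "\<delta> {i, j} = tree_dist T w i j" if "i \<in> {1..n}" "j \<in> {1..n}" for i j
  proof -
    have "i \<in> pverts T" "j \<in> pverts T" using that verts by blast+
    then show ?thesis using tree_dist_sym[OF tree, of i j w] by (auto simp: \<delta>_def min_def max_def)
  qed
  interpret four_point_pairs n \<delta>
  proof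
    fix a b c d
    show "\<delta> {a, b} \<le> \<delta> {a, c} + \<delta> {c, b}" if "{a, b, c} \<subseteq> {1..n}"
      using tree_dist_triangle[OF T subset_trans[OF that verts]] that by (simp add: \<delta>)
    show "\<delta> {a, b} + \<delta> {c, d} \<le> max (\<delta> {a, c} + \<delta> {b, d}) (\<delta> {a, d} + \<delta> {b, c})"
      if "{a, b, c, d} \<subseteq> {1..n}"
      using tree_dist_four_point[OF T subset_trans[OF that verts]] that by (simp add: \<delta>)
  qed
  have between: "m p < \<delta> p" "\<delta> p < M p" if "p \<in> [{1..n}]\<^bsup>2\<^esup>" for p
    using that bounds \<delta> by (auto elim!: nsets2_E)
  have "(\<Sum>p\<in>#\<sigma>. m p) < (\<Sum>p\<in>#\<tau>. M p)"
    if \<sigma>: "\<sigma> \<noteq> {#}" "set_mset \<sigma> \<subseteq> [{1..n}]\<^bsup>2\<^esup>" and reach: "(transform n S)\<^sup>*\<^sup>* \<sigma> \<tau>" for \<sigma> \<tau>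
  proof -
    have \<tau>: "set_mset \<tau> \<subseteq> [{1..n}]\<^bsup>2\<^esup>" and le: "(\<Sum>p\<in>#\<sigma>. \<delta> p) \<le> (\<Sum>p\<in>#\<tau>. \<delta> p)"
      using reach_mono[OF reach \<sigma>(2)] by auto
    \<comment> \<open>Strictness comes from this step, where \<open>\<sigma>\<close> is
      nonempty.\<close>
    have "(\<Sum>p\<in>#\<sigma>. m p) < (\<Sum>p\<in>#\<sigma>. \<delta> p)"
      using \<sigma> between(1) by (intro sum_mset_strict_mono) auto
    also note le
    also have "(\<Sum>p\<in>#\<tau>. \<delta> p) \<le> (\<Sum>p\<in>#\<tau>. M p)"
      using \<tau> between(2) by (intro sum_mset_mono) (auto intro: less_imp_le)
    finally show ?thesis .
  qed
  then show ?system using S_split_system S_fat S_transitive S_saturated by blast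
next
  assume ?system
  then obtain S where S: "split_system n S" "fat n S" "transitive n S" "saturated n S"
    and less: "\<And>\<sigma> \<tau>. \<sigma> \<noteq> {#} \<Longrightarrow> set_mset \<sigma> \<subseteq> [{1..n}]\<^bsup>2\<^esup> \<Longrightarrow> set_mset \<tau> \<subseteq> [{1..n}]\<^bsup>2\<^esup> \<Longrightarrow>
      (transform n S)\<^sup>*\<^sup>* \<sigma> \<tau> \<Longrightarrow> (\<Sum>I\<in>#\<sigma>. m I) < (\<Sum>I\<in>#\<tau>. M I)"
    by blast
  interpret quartet_system n S using S by unfold_locales
  obtain \<omega> where pos: "\<And>X. X \<in> clusters \<Longrightarrow> 0 < \<omega> X"
    and \<omega>: "\<And>p. p \<in> [{1..n}]\<^bsup>2\<^esup> \<Longrightarrow> (\<Sum>X\<in>clusters. of_bool (crosses p X) * \<omega> X) \<in> {m p<..<M p}"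
    using weights_exist[of M m] assms(3) less unfolding N_def by blast
  interpret laminar_family n clusters \<omega>
    using assms(1) pos by (rule clusters_laminar)
  have "tree_dist T (\<lambda>e. \<omega> (\<Inter>(dec ` e))) i j \<in> {m {i, j}<..<M {i, j}}"
    if "i \<in> {1..n}" "j \<in> {1..n}" "i \<noteq> j" for i j
    unfolding tree_dist_leaves[OF that(1,2)] using \<omega>[of "{i, j}"] that by simp
  then show ?tree using positive_weighted_tree_T leaves_T by blast
qed

end
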